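(* Let $A$ be a $C^*$-algebra and let $\mathcal{M}$ be a full Hilbert $A$-module. Let $T:\mathcal{M}\to\mathcal{M}$ be an orthogonality-preserving bounded $A$-linear operator. Then there exists a positive element $\kappa\in Z(M(A))$ (depending on $T$), where $Z(M(A))$ is the centre of the multiplier algebra $M(A)$ of $A$, such that \[ \langle T(x),T(y)\rangle=\kappa\,\langle x,y\rangle \] for all $x,y\in\mathcal{M}$.
   Context: $C^*$-algebras are not assumed unital. A Hilbert $A$-module $\mathcal{M}$ is a left $A$-module (with compatible complex linear structure) equipped with an $A$-valued inner product $\langle\cdot,\cdot\rangle:\mathcal{M}\times\mathcal{M}\to A$ that is $A$-linear in the first variable, satisfies $\langle x,y\rangle=\langle y,x\rangle^*$ and $\langle x,x\rangle\ge 0$ with equality iff $x=0$, and such that $\mathcal{M}$ is complete in the norm $\|x\|=\|\langle x,x\rangle\|^{1/2}$. It is full if the linear span of $\{\langle x,y\rangle:x,y\in\mathcal{M}\}$ is norm-dense in $A$. A bounded $A$-linear operator $T$ on $\mathcal{M}$ is orthogonality-preserving if for all $x,y\in\mathcal{M}$, $\langle x,y\rangle=0$ implies $\langle T(x),T(y)\rangle=0$. *)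

theory Defs
  imports "HOL-Analysis.Analysis"
begin

section \<open>Complex Banach spaces\<close>

class scaleC = scaleR +
  fixes scaleC :: "complex \<Rightarrow> 'a \<Rightarrow> 'a" (infixr "*\<^sub>C" 75)
  assumes scaleR_scaleC: "r *\<^sub>R x = complex_of_real r *\<^sub>C x"

class complex_banach = scaleC + banach +
  assumes scaleC_add_right: "c *\<^sub>C (x + y) = c *\<^sub>C x + c *\<^sub>C y"
    and scaleC_add_left: "(c + d) *\<^sub>C x = c *\<^sub>C x + d *\<^sub>C x"
    and scaleC_scaleC: "c *\<^sub>C d *\<^sub>C x = (c * d) *\<^sub>C x"
    and scaleC_one: "1 *\<^sub>C x = x"
    and norm_scaleC: "norm (c *\<^sub>C x) = cmod c * norm x"

global_interpretation complex_vector: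
  vector_space "scaleC :: complex \<Rightarrow> 'a \<Rightarrow> 'a :: complex_banach"
  defines cspan_raw_def: cspan = complex_vector.span
  by unfold_locales
    (simp_all add: scaleC_add_right scaleC_add_left scaleC_scaleC scaleC_one)

definition bounded_clinear :: "('a::complex_banach \<Rightarrow> 'b::complex_banach) \<Rightarrow> bool" where
  "bounded_clinear f \<longleftrightarrow> bounded_linear f \<and> (\<forall>c x. f (c *\<^sub>C x) = c *\<^sub>C f x)"


section \<open>C*-algebras\<close>

class cstar_algebra = complex_banach + real_normed_algebra +
  fixes adj :: "'a \<Rightarrow> 'a"
  assumes scaleC_mult_left: "(c *\<^sub>C a) * b = c *\<^sub>C (a * b)"
    and scaleC_mult_right: "a * (c *\<^sub>C b) = c *\<^sub>C (a * b)"
    and adj_adj: "adj (adj a) = a"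
    and adj_add: "adj (a + b) = adj a + adj b"
    and adj_scaleC: "adj (c *\<^sub>C a) = cnj c *\<^sub>C adj a"
    and adj_mult: "adj (a * b) = adj b * adj a"
    and cstar_identity: "norm (adj a * a) = (norm a)\<^sup>2"

definition positive_element :: "'a::cstar_algebra \<Rightarrow> bool" where
  "positive_element a \<longleftrightarrow> (\<exists>b. a = adj b * b)"

definition centre :: "'a::times set" where
  "centre = {z. \<forall>a. z * a = a * z}"


section \<open>The multiplier algebra\<close>

text \<open>The multiplier algebra of \<open>A\<close> is realised as the algebra of double centralizers of \<open>A\<close>.\<close>

definition double_centralizer :: "('a::cstar_algebra \<Rightarrow> 'a) \<Rightarrow> ('a \<Rightarrow> 'a) \<Rightarrow> bool" where
  "double_centralizer L R \<longleftrightarrow> bounded_clinear L \<and> bounded_clinear R \<and>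
     (\<forall>a b. L (a * b) = L a * b) \<and> (\<forall>a b. R (a * b) = a * R b) \<and>
     (\<forall>a b. R a * b = a * L b)"

lemma adj_zero [simp]: "adj (0::'a::cstar_algebra) = 0"
  using adj_add[of "0::'a" 0] by simp

lemma adj_minus: "adj (- a) = - adj (a::'a::cstar_algebra)"
  using adj_add[of a "- a"] by (simp add: eq_neg_iff_add_eq_0 add.commute)

lemma adj_diff: "adj (a - b) = adj a - adj (b::'a::cstar_algebra)"
  using adj_add[of a "- b"] by (simp add: adj_minus)

lemma adj_scaleR: "adj (r *\<^sub>R a) = r *\<^sub>R adj (a::'a::cstar_algebra)"
  by (simp add: scaleR_scaleC adj_scaleC)

lemma norm_adj [simp]: "norm (adj a) = norm (a::'a::cstar_algebra)"
proof -
  have le: "norm b \<le> norm (adj b)" for b :: 'a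
  proof (cases "norm b = 0")
    case False
    have "norm b * norm b = norm (adj b * b)"
      by (simp add: cstar_identity power2_eq_square)
    also have "\<dots> \<le> norm (adj b) * norm b" by (rule norm_mult_ineq)
    finally show ?thesis using False by simp
  qed auto
  show ?thesis using le[of a] le[of "adj a"] by (simp add: adj_adj)
qed

lemma scaleC_diff: "c *\<^sub>C (x - y) = c *\<^sub>C x - c *\<^sub>C (y::'a::complex_banach)"
  by (rule complex_vector.scale_right_diff_distrib)

lemma scaleC_minus: "c *\<^sub>C (- x) = - (c *\<^sub>C (x::'a::complex_banach))"
  by (rule complex_vector.scale_minus_right)

lemma scaleC_zero: "c *\<^sub>C (0::'a::complex_banach) = 0"
  by (rule complex_vector.scale_zero_right)

lemma bounded_linear_scaleC: "bounded_linear (\<lambda>x::'a::complex_banach. c *\<^sub>C x)"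
  by (rule bounded_linear_intro[where K = "cmod c"])
    (simp_all add: scaleC_add_right scaleR_scaleC scaleC_scaleC norm_scaleC mult.commute)

lemma bounded_linear_adj: "bounded_linear (adj :: 'a::cstar_algebra \<Rightarrow> 'a)"
  by (rule bounded_linear_intro[where K = 1]) (simp_all add: adj_add adj_scaleR)

lemma bounded_clinear_zero: "bounded_clinear (\<lambda>_. 0)"
  by (simp add: bounded_clinear_def bounded_linear_zero scaleC_zero)

lemma bounded_clinear_plus:
  "bounded_clinear f \<Longrightarrow> bounded_clinear g \<Longrightarrow> bounded_clinear (\<lambda>x. f x + g x)"
  by (simp add: bounded_clinear_def bounded_linear_add scaleC_add_right)

lemma bounded_clinear_diff:
  "bounded_clinear f \<Longrightarrow> bounded_clinear g \<Longrightarrow> bounded_clinear (\<lambda>x. f x - g x)"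
  by (simp add: bounded_clinear_def bounded_linear_sub scaleC_diff)

lemma bounded_clinear_minus: "bounded_clinear f \<Longrightarrow> bounded_clinear (\<lambda>x. - f x)"
  by (simp add: bounded_clinear_def bounded_linear_minus scaleC_minus)

lemma bounded_clinear_scaleC: "bounded_clinear f \<Longrightarrow> bounded_clinear (\<lambda>x. c *\<^sub>C f x)"
  by (simp add: bounded_clinear_def bounded_linear_compose[OF bounded_linear_scaleC]
      scaleC_scaleC mult.commute)

lemma bounded_clinear_compose:
  "bounded_clinear f \<Longrightarrow> bounded_clinear g \<Longrightarrow> bounded_clinear (\<lambda>x. f (g x))"
  by (simp add: bounded_clinear_def bounded_linear_compose)

lemma bounded_clinear_adj_conj:
  fixes f :: "'a::cstar_algebra \<Rightarrow> 'a"
  shows "bounded_clinear f \<Longrightarrow> bounded_clinear (\<lambda>x. adj (f (adj x)))"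
  by (simp add: bounded_clinear_def adj_scaleC
      bounded_linear_compose[OF bounded_linear_adj bounded_linear_compose[OF _ bounded_linear_adj]])

lemmas bounded_clinear_intros =
  bounded_clinear_zero bounded_clinear_plus bounded_clinear_diff bounded_clinear_minus
  bounded_clinear_scaleC bounded_clinear_compose bounded_clinear_adj_conj

typedef (overloaded) 'a multiplier =
  "{(L, R). double_centralizer L (R :: 'a::cstar_algebra \<Rightarrow> 'a)}"
proof
  show "((\<lambda>_. 0), (\<lambda>_. 0)) \<in> {(L, R). double_centralizer L (R :: 'a::cstar_algebra \<Rightarrow> 'a)}"
    by (simp add: double_centralizer_def bounded_clinear_zero)
qed

definition left_mult :: "'a::cstar_algebra multiplier \<Rightarrow> 'a \<Rightarrow> 'a" where
  "left_mult m = fst (Rep_multiplier m)"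

definition right_mult :: "'a::cstar_algebra multiplier \<Rightarrow> 'a \<Rightarrow> 'a" where
  "right_mult m = snd (Rep_multiplier m)"

lemma double_centralizer_mult: "double_centralizer (left_mult m) (right_mult m)"
  using Rep_multiplier[of m] by (simp add: left_mult_def right_mult_def case_prod_beta)

lemma left_mult_Abs: "double_centralizer L R \<Longrightarrow> left_mult (Abs_multiplier (L, R)) = L"
  by (simp add: left_mult_def Abs_multiplier_inverse)

lemma right_mult_Abs: "double_centralizer L R \<Longrightarrow> right_mult (Abs_multiplier (L, R)) = R"
  by (simp add: right_mult_def Abs_multiplier_inverse)

lemma multiplier_eqI:
  assumes "\<And>a. left_mult m a = left_mult n a" and "\<And>a. right_mult m a = right_mult n a"
  shows "m = n"
proof -
  have "Rep_multiplier m = Rep_multiplier n"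
    using assms by (intro prod_eqI ext) (simp_all add: left_mult_def right_mult_def)
  then show ?thesis by (simp add: Rep_multiplier_inject)
qed

lemma
  fixes m :: "'a::cstar_algebra multiplier"
  shows bounded_clinear_left_mult: "bounded_clinear (left_mult m)"
    and bounded_clinear_right_mult: "bounded_clinear (right_mult m)"
    and left_mult_times: "left_mult m (a * b) = left_mult m a * b"
    and right_mult_times: "right_mult m (a * b) = a * right_mult m b"
    and right_left_mult: "right_mult m a * b = a * left_mult m b"
  using double_centralizer_mult[of m] by (auto simp: double_centralizer_def)

lemma bounded_linear_left_mult: "bounded_linear (left_mult m)"
  using bounded_clinear_left_mult[of m] by (simp add: bounded_clinear_def)

lemma bounded_linear_right_mult: "bounded_linear (right_mult m)"
  using bounded_clinear_right_mult[of m] by (simp add: bounded_clinear_def)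

lemma left_mult_scaleC: "left_mult m (c *\<^sub>C a) = c *\<^sub>C left_mult m a"
  using bounded_clinear_left_mult[of m] by (simp add: bounded_clinear_def)

lemma right_mult_scaleC: "right_mult m (c *\<^sub>C a) = c *\<^sub>C right_mult m a"
  using bounded_clinear_right_mult[of m] by (simp add: bounded_clinear_def)

instantiation multiplier :: (cstar_algebra) scaleR
begin

definition scaleR_multiplier :: "real \<Rightarrow> 'a multiplier \<Rightarrow> 'a multiplier" where
  "scaleR_multiplier r m = Abs_multiplier (\<lambda>a. r *\<^sub>R left_mult m a, \<lambda>a. r *\<^sub>R right_mult m a)"

instance ..

end

instantiation multiplier :: (cstar_algebra) "{zero, plus, minus, uminus, scaleC, times}"
begin

definition "0 = Abs_multiplier (\<lambda>_. 0, \<lambda>_. 0)"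

definition "m + n = Abs_multiplier
  (\<lambda>a. left_mult m a + left_mult n a, \<lambda>a. right_mult m a + right_mult n a)"

definition "m - n = Abs_multiplier
  (\<lambda>a. left_mult m a - left_mult n a, \<lambda>a. right_mult m a - right_mult n a)"

definition "- m = Abs_multiplier (\<lambda>a. - left_mult m a, \<lambda>a. - right_mult m a)"

definition scaleC_multiplier :: "complex \<Rightarrow> 'a multiplier \<Rightarrow> 'a multiplier" where
  "scaleC_multiplier c m = Abs_multiplier (\<lambda>a. c *\<^sub>C left_mult m a, \<lambda>a. c *\<^sub>C right_mult m a)"

definition "m * n = Abs_multiplier
  (\<lambda>a. left_mult m (left_mult n a), \<lambda>a. right_mult n (right_mult m a))"

instance
  by standard (simp add: scaleR_multiplier_def scaleC_multiplier_def scaleR_scaleC)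

end

lemma
  fixes m n :: "'a::cstar_algebra multiplier"
  shows left_mult_zero_multiplier [simp]: "left_mult (0 :: 'a multiplier) a = 0"
    and right_mult_zero_multiplier [simp]: "right_mult (0 :: 'a multiplier) a = 0"
    and left_mult_plus_multiplier [simp]: "left_mult (m + n) a = left_mult m a + left_mult n a"
    and right_mult_plus_multiplier [simp]: "right_mult (m + n) a = right_mult m a + right_mult n a"
    and left_mult_minus_multiplier [simp]: "left_mult (m - n) a = left_mult m a - left_mult n a"
    and right_mult_minus_multiplier [simp]: "right_mult (m - n) a = right_mult m a - right_mult n a"
    and left_mult_uminus_multiplier [simp]: "left_mult (- m) a = - left_mult m a"
    and right_mult_uminus_multiplier [simp]: "right_mult (- m) a = - right_mult m a"
    and left_mult_scaleC_multiplier [simp]: "left_mult (c *\<^sub>C m) a = c *\<^sub>C left_mult m a"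
    and right_mult_scaleC_multiplier [simp]: "right_mult (c *\<^sub>C m) a = c *\<^sub>C right_mult m a"
    and left_mult_times_multiplier [simp]: "left_mult (m * n) a = left_mult m (left_mult n a)"
    and right_mult_times_multiplier [simp]: "right_mult (m * n) a = right_mult n (right_mult m a)"
proof -
  note dc = double_centralizer_def bounded_clinear_intros bounded_clinear_left_mult
    bounded_clinear_right_mult left_mult_times right_mult_times right_left_mult
    scaleC_mult_left scaleC_mult_right algebra_simps
  have zero: "double_centralizer (\<lambda>_. 0) (\<lambda>_::'a. 0)"
    by (simp add: dc)
  show "left_mult (0 :: 'a multiplier) a = 0" "right_mult (0 :: 'a multiplier) a = 0"
    by (simp_all add: zero_multiplier_def left_mult_Abs[OF zero] right_mult_Abs[OF zero])
  have plus: "double_centralizer (\<lambda>a. left_mult m a + left_mult n a)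
      (\<lambda>a. right_mult m a + right_mult n a)"
    by (simp add: dc)
  show "left_mult (m + n) a = left_mult m a + left_mult n a"
    "right_mult (m + n) a = right_mult m a + right_mult n a"
    by (simp_all add: plus_multiplier_def left_mult_Abs[OF plus] right_mult_Abs[OF plus])
  have minus: "double_centralizer (\<lambda>a. left_mult m a - left_mult n a)
      (\<lambda>a. right_mult m a - right_mult n a)"
    by (simp add: dc)
  show "left_mult (m - n) a = left_mult m a - left_mult n a"
    "right_mult (m - n) a = right_mult m a - right_mult n a"
    by (simp_all add: minus_multiplier_def left_mult_Abs[OF minus] right_mult_Abs[OF minus])
  have uminus: "double_centralizer (\<lambda>a. - left_mult m a) (\<lambda>a. - right_mult m a)"
    by (simp add: dc)
  show "left_mult (- m) a = - left_mult m a" "right_mult (- m) a = - right_mult m a"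
    by (simp_all add: uminus_multiplier_def left_mult_Abs[OF uminus] right_mult_Abs[OF uminus])
  have scale: "double_centralizer (\<lambda>a. c *\<^sub>C left_mult m a) (\<lambda>a. c *\<^sub>C right_mult m a)"
    by (simp add: dc)
  show "left_mult (c *\<^sub>C m) a = c *\<^sub>C left_mult m a" "right_mult (c *\<^sub>C m) a = c *\<^sub>C right_mult m a"
    by (simp_all add: scaleC_multiplier_def left_mult_Abs[OF scale] right_mult_Abs[OF scale])
  have times: "double_centralizer (\<lambda>a. left_mult m (left_mult n a))
      (\<lambda>a. right_mult n (right_mult m a))"
    by (simp add: dc)
  show "left_mult (m * n) a = left_mult m (left_mult n a)"
    "right_mult (m * n) a = right_mult n (right_mult m a)"
    by (simp_all add: times_multiplier_def left_mult_Abs[OF times] right_mult_Abs[OF times])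
qed

lemma norm_left_mult: "norm (left_mult m a) \<le> onorm (left_mult m) * norm a"
  by (rule onorm[OF bounded_linear_left_mult])

lemma norm_right_mult: "norm (right_mult m a) \<le> onorm (right_mult m) * norm a"
  by (rule onorm[OF bounded_linear_right_mult])

lemma onorm_left_right_mult: "onorm (left_mult m) = onorm (right_mult m)"
proof (rule antisym)
  show "onorm (left_mult m) \<le> onorm (right_mult m)"
  proof (rule onorm_bound)
    show "0 \<le> onorm (right_mult m)" by (rule onorm_pos_le[OF bounded_linear_right_mult])
    fix a :: 'a
    let ?l = "left_mult m a"
    have "norm ?l * norm ?l = norm (right_mult m (adj ?l) * a)"
      by (simp add: right_left_mult cstar_identity power2_eq_square)
    also have "\<dots> \<le> norm (right_mult m (adj ?l)) * norm a" by (rule norm_mult_ineq)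
    also have "\<dots> \<le> onorm (right_mult m) * norm ?l * norm a"
      using norm_right_mult[of m "adj ?l"] by (intro mult_right_mono) simp_all
    finally have *: "norm ?l * norm ?l \<le> (onorm (right_mult m) * norm a) * norm ?l"
      by (simp add: mult_ac)
    show "norm ?l \<le> onorm (right_mult m) * norm a"
    proof (cases "norm ?l = 0")
      case False
      then show ?thesis using * mult_le_cancel_right[of "norm ?l" "norm ?l"] by simp
    next
      case True
      then show ?thesis
        using \<open>0 \<le> onorm (right_mult m)\<close> by simp
    qed
  qed
  show "onorm (right_mult m) \<le> onorm (left_mult m)"
  proof (rule onorm_bound)
    show "0 \<le> onorm (left_mult m)" by (rule onorm_pos_le[OF bounded_linear_left_mult])
    fix a :: 'a
    let ?r = "right_mult m a"
    have "norm ?r * norm ?r = norm (adj (adj ?r) * adj ?r)"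
      by (simp only: cstar_identity norm_adj power2_eq_square)
    also have "\<dots> = norm (a * left_mult m (adj ?r))"
      by (simp add: right_left_mult adj_adj)
    also have "\<dots> \<le> norm a * norm (left_mult m (adj ?r))" by (rule norm_mult_ineq)
    also have "\<dots> \<le> norm a * (onorm (left_mult m) * norm ?r)"
      using norm_left_mult[of m "adj ?r"] by (intro mult_left_mono) simp_all
    finally have *: "norm ?r * norm ?r \<le> (onorm (left_mult m) * norm a) * norm ?r"
      by (simp add: mult_ac)
    show "norm ?r \<le> onorm (left_mult m) * norm a"
    proof (cases "norm ?r = 0")
      case False
      then show ?thesis using * mult_le_cancel_right[of "norm ?r" "norm ?r"] by simp
    next
      case True
      then show ?thesis
        using \<open>0 \<le> onorm (left_mult m)\<close> by simp
    qed
  qed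
qed

lemma double_centralizer_adj:
  "double_centralizer (\<lambda>a. adj (right_mult m (adj a))) (\<lambda>a. adj (left_mult m (adj a)))"
proof -
  have "adj (left_mult m (adj a)) * b = a * adj (right_mult m (adj b))" for a b
    by (metis adj_adj adj_mult right_left_mult)
  then show ?thesis
    by (simp add: double_centralizer_def bounded_clinear_intros bounded_clinear_left_mult
        bounded_clinear_right_mult adj_mult adj_adj left_mult_times right_mult_times)
qed

instantiation multiplier :: (cstar_algebra) real_normed_algebra
begin

definition norm_multiplier :: "'a multiplier \<Rightarrow> real" where
  "norm_multiplier m = onorm (left_mult m)"

definition dist_multiplier :: "'a multiplier \<Rightarrow> 'a multiplier \<Rightarrow> real" where
  "dist_multiplier m n = norm (m - n)"

definition sgn_multiplier :: "'a multiplier \<Rightarrow> 'a multiplier" where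
  "sgn_multiplier m = m /\<^sub>R norm m"

definition uniformity_multiplier :: "('a multiplier \<times> 'a multiplier) filter" where
  "uniformity_multiplier = (INF e\<in>{0<..}. principal {(m, n). dist m n < e})"

definition open_multiplier :: "'a multiplier set \<Rightarrow> bool" where
  "open_multiplier U \<longleftrightarrow> (\<forall>m\<in>U. \<forall>\<^sub>F (m', n) in uniformity. m' = m \<longrightarrow> n \<in> U)"

lemma scaleR_left_right:
  "left_mult (r *\<^sub>R m) a = r *\<^sub>R left_mult m a" "right_mult (r *\<^sub>R m) a = r *\<^sub>R right_mult m a"
  for m :: "'a multiplier"
  by (simp_all add: scaleR_scaleC)

lemma norm_left_mult_le: "norm (left_mult m a) \<le> norm m * norm a"
  by (simp add: norm_multiplier_def norm_left_mult)

lemma norm_right_mult_le: "norm (right_mult m a) \<le> norm m * norm a"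
  by (simp add: norm_multiplier_def norm_right_mult onorm_left_right_mult)

lemma norm_multiplier_nonneg: "0 \<le> norm (m :: 'a multiplier)"
  by (simp add: norm_multiplier_def onorm_pos_le[OF bounded_linear_left_mult])

lemma norm_multiplier_bound:
  "0 \<le> K \<Longrightarrow> (\<And>a. norm (left_mult m a) \<le> K * norm a) \<Longrightarrow> norm m \<le> K"
  unfolding norm_multiplier_def by (rule onorm_bound)

lemma norm_scaleC_multiplier: "norm (c *\<^sub>C m) = cmod c * norm m" for m :: "'a multiplier"
proof -
  have le: "norm (c *\<^sub>C m) \<le> cmod c * norm m" for c and m :: "'a multiplier"
  proof (rule norm_multiplier_bound)
    show "0 \<le> cmod c * norm m" by (simp add: norm_multiplier_nonneg)
    show "norm (left_mult (c *\<^sub>C m) a) \<le> cmod c * norm m * norm a" for a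
      using norm_left_mult_le[of m a] by (simp add: norm_scaleC mult.assoc mult_left_mono)
  qed
  show ?thesis
  proof (cases "c = 0")
    case True
    then show ?thesis using le[of c m] norm_multiplier_nonneg[of "c *\<^sub>C m"] by simp
  next
    case False
    have "m = inverse c *\<^sub>C c *\<^sub>C m"
      using False by (auto intro!: multiplier_eqI simp: scaleC_scaleC scaleC_one)
    then have "norm m \<le> cmod (inverse c) * norm (c *\<^sub>C m)"
      using le[of "inverse c" "c *\<^sub>C m"] by simp
    then have "cmod c * norm m \<le> norm (c *\<^sub>C m)"
      using False by (simp add: norm_divide field_simps)
    then show ?thesis using le[of c m] by simp
  qed
qed

lemma scaleC_times_multiplier: "(c *\<^sub>C m) * n = c *\<^sub>C (m * n)" "m * (c *\<^sub>C n) = c *\<^sub>C (m * n)"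
  for m n :: "'a multiplier"
  by (auto intro!: multiplier_eqI simp: left_mult_scaleC right_mult_scaleC)

instance
proof
  fix l m n :: "'a multiplier" and r s :: real
  show "l + m + n = l + (m + n)" "m + n = n + m" "0 + m = m" "- m + m = 0" "m - n = m + - n"
    by (auto intro!: multiplier_eqI)
  show "r *\<^sub>R (m + n) = r *\<^sub>R m + r *\<^sub>R n" "(r + s) *\<^sub>R m = r *\<^sub>R m + s *\<^sub>R m"
    "r *\<^sub>R s *\<^sub>R m = (r * s) *\<^sub>R m" "1 *\<^sub>R m = m"
    by (auto intro!: multiplier_eqI simp: scaleR_left_right algebra_simps)
  show "dist m n = norm (m - n)" by (rule dist_multiplier_def)
  show "sgn m = m /\<^sub>R norm m" by (rule sgn_multiplier_def)
  show "uniformity = (INF e\<in>{0<..}. principal {(x, y :: 'a multiplier). dist x y < e})"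
    by (rule uniformity_multiplier_def)
  show "open U \<longleftrightarrow> (\<forall>x\<in>U. \<forall>\<^sub>F (x', y) in uniformity. x' = x \<longrightarrow> y \<in> U)"
    for U :: "'a multiplier set"
    by (rule open_multiplier_def)
  show "norm m = 0 \<longleftrightarrow> m = 0"
  proof
    assume "norm m = 0"
    then show "m = 0"
      using norm_left_mult_le[of m] norm_right_mult_le[of m] by (auto intro!: multiplier_eqI)
  next
    assume "m = 0"
    then show "norm m = 0"
      using norm_multiplier_bound[of 0 m] norm_multiplier_nonneg[of m] by simp
  qed
  show "norm (m + n) \<le> norm m + norm n"
  proof (rule norm_multiplier_bound)
    show "0 \<le> norm m + norm n" by (simp add: norm_multiplier_nonneg)
    show "norm (left_mult (m + n) a) \<le> (norm m + norm n) * norm a" for a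
      using norm_left_mult_le[of m a] norm_left_mult_le[of n a]
      by (simp add: algebra_simps norm_triangle_le)
  qed
  show "norm (r *\<^sub>R m) = \<bar>r\<bar> * norm m"
    by (simp add: scaleR_scaleC norm_scaleC_multiplier)
  show "l * m * n = l * (m * n)" by (auto intro!: multiplier_eqI)
  note add = linear_add[OF bounded_linear.linear[OF bounded_linear_left_mult]]
    linear_add[OF bounded_linear.linear[OF bounded_linear_right_mult]]
  show "(l + m) * n = l * n + m * n" "l * (m + n) = l * m + l * n"
    by (auto intro!: multiplier_eqI simp: add)
  show "r *\<^sub>R m * n = r *\<^sub>R (m * n)" "m * r *\<^sub>R n = r *\<^sub>R (m * n)"
    by (simp_all add: scaleR_scaleC scaleC_times_multiplier)
  show "norm (m * n) \<le> norm m * norm n"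
  proof (rule norm_multiplier_bound)
    show "0 \<le> norm m * norm n" by (simp add: norm_multiplier_nonneg)
    show "norm (left_mult (m * n) a) \<le> norm m * norm n * norm a" for a
    proof -
      have "norm (left_mult m (left_mult n a)) \<le> norm m * norm (left_mult n a)"
        by (rule norm_left_mult_le)
      also have "\<dots> \<le> norm m * (norm n * norm a)"
        by (intro mult_left_mono norm_left_mult_le norm_multiplier_nonneg)
      finally show ?thesis by (simp add: mult.assoc)
    qed
  qed
qed

end

instantiation multiplier :: (cstar_algebra) cstar_algebra
begin

definition adj_multiplier :: "'a multiplier \<Rightarrow> 'a multiplier" where
  "adj_multiplier m = Abs_multiplier
    (\<lambda>a. adj (right_mult m (adj a)), \<lambda>a. adj (left_mult m (adj a)))"

lemma left_mult_adj: "left_mult (adj m) a = adj (right_mult m (adj a))"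
  by (simp add: adj_multiplier_def left_mult_Abs[OF double_centralizer_adj])

lemma right_mult_adj: "right_mult (adj m) a = adj (left_mult m (adj a))"
  by (simp add: adj_multiplier_def right_mult_Abs[OF double_centralizer_adj])

instance
proof
  fix m n :: "'a multiplier" and c d :: complex
  show "c *\<^sub>C (m + n) = c *\<^sub>C m + c *\<^sub>C n" "(c + d) *\<^sub>C m = c *\<^sub>C m + d *\<^sub>C m"
    "c *\<^sub>C d *\<^sub>C m = (c * d) *\<^sub>C m" "1 *\<^sub>C m = m"
    by (auto intro!: multiplier_eqI
        simp: scaleC_add_right scaleC_add_left scaleC_scaleC scaleC_one)
  show "norm (c *\<^sub>C m) = cmod c * norm m" by (rule norm_scaleC_multiplier)
  show "(c *\<^sub>C m) * n = c *\<^sub>C (m * n)" "m * (c *\<^sub>C n) = c *\<^sub>C (m * n)"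
    by (rule scaleC_times_multiplier)+
  show "adj (adj m) = m" "adj (m + n) = adj m + adj n" "adj (c *\<^sub>C m) = cnj c *\<^sub>C adj m"
    "adj (m * n) = adj n * adj m"
    by (auto intro!: multiplier_eqI
        simp: left_mult_adj right_mult_adj adj_adj adj_add adj_scaleC)
  show "norm (adj m * m) = (norm m)\<^sup>2"
  proof (rule antisym)
    have norm_adj_le: "norm (adj m) \<le> norm m"
      using norm_multiplier_bound[of "norm m" "adj m"] norm_right_mult_le[of m "adj _"]
      by (simp add: left_mult_adj norm_multiplier_nonneg)
    have "norm (adj m * m) \<le> norm (adj m) * norm m" by (rule norm_mult_ineq)
    also have "\<dots> \<le> norm m * norm m"
      by (intro mult_right_mono norm_adj_le norm_multiplier_nonneg)
    finally show "norm (adj m * m) \<le> (norm m)\<^sup>2" by (simp add: power2_eq_square)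
    let ?K = "norm (adj m * m)"
    have "norm m \<le> sqrt ?K"
    proof (rule norm_multiplier_bound)
      show "0 \<le> sqrt ?K" by (simp add: norm_multiplier_nonneg)
      fix a :: 'a
      have "(norm (left_mult m a))\<^sup>2 = norm (adj (left_mult m a) * left_mult m a)"
        by (simp add: cstar_identity)
      also have "adj (left_mult m a) * left_mult m a = adj a * left_mult (adj m * m) a"
        by (metis adj_adj left_mult_times_multiplier right_left_mult right_mult_adj)
      also have "norm \<dots> \<le> norm (adj a) * norm (left_mult (adj m * m) a)"
        by (rule norm_mult_ineq)
      also have "\<dots> \<le> norm a * (?K * norm a)"
        by (simp only: norm_adj) (intro mult_left_mono norm_left_mult_le norm_ge_zero)
      finally have "(norm (left_mult m a))\<^sup>2 \<le> ?K * (norm a)\<^sup>2"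
        by (simp add: power2_eq_square mult_ac)
      then have "sqrt ((norm (left_mult m a))\<^sup>2) \<le> sqrt (?K * (norm a)\<^sup>2)"
        by (rule real_sqrt_le_mono)
      then show "norm (left_mult m a) \<le> sqrt ?K * norm a"
        by (simp add: real_sqrt_mult)
    qed
    then have "(norm m)\<^sup>2 \<le> (sqrt ?K)\<^sup>2"
      by (intro power_mono norm_multiplier_nonneg)
    then show "(norm m)\<^sup>2 \<le> ?K" by (simp add: norm_multiplier_nonneg)
  qed
next
  fix X :: "nat \<Rightarrow> 'a multiplier"
  assume "Cauchy X"
  then have small: "\<exists>N. \<forall>i\<ge>N. \<forall>j\<ge>N. norm (X i - X j) < e" if "e > 0" for e
    using that by (simp add: Cauchy_def dist_multiplier_def)
  define L where "L k = Blinfun (left_mult (X k))" for k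
  define R where "R k = Blinfun (right_mult (X k))" for k
  have L: "blinfun_apply (L k) = left_mult (X k)" and R: "blinfun_apply (R k) = right_mult (X k)" for k
    by (simp_all add: L_def R_def bounded_linear_Blinfun_apply bounded_linear_left_mult
        bounded_linear_right_mult)
  have nL: "norm (L i - L j) \<le> norm (X i - X j)" for i j
    using norm_left_mult_le[of "X i - X j"]
    by (intro norm_blinfun_bound norm_multiplier_nonneg) (simp add: blinfun.diff_left L)
  have nR: "norm (R i - R j) \<le> norm (X i - X j)" for i j
    using norm_right_mult_le[of "X i - X j"]
    by (intro norm_blinfun_bound norm_multiplier_nonneg) (simp add: blinfun.diff_left R)
  have "Cauchy L" "Cauchy R"
    unfolding Cauchy_def dist_norm by (meson small nL nR le_less_trans)+
  then obtain l r where l: "L \<longlonglongrightarrow> l" and r: "R \<longlonglongrightarrow> r"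
    by (meson Cauchy_convergent convergentD)
  have la: "(\<lambda>k. left_mult (X k) a) \<longlonglongrightarrow> blinfun_apply l a" for a
    using blinfun.tendsto[OF l tendsto_const[of a]] by (simp add: L)
  have ra: "(\<lambda>k. right_mult (X k) a) \<longlonglongrightarrow> blinfun_apply r a" for a
    using blinfun.tendsto[OF r tendsto_const[of a]] by (simp add: R)
  have scl: "blinfun_apply l (c *\<^sub>C a) = c *\<^sub>C blinfun_apply l a" for c a
    using LIMSEQ_unique[OF la[of "c *\<^sub>C a"]]
      bounded_linear.tendsto[OF bounded_linear_scaleC la[of a], of c]
    by (simp add: left_mult_scaleC)
  have scr: "blinfun_apply r (c *\<^sub>C a) = c *\<^sub>C blinfun_apply r a" for c a
    using LIMSEQ_unique[OF ra[of "c *\<^sub>C a"]]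
      bounded_linear.tendsto[OF bounded_linear_scaleC ra[of a], of c]
    by (simp add: right_mult_scaleC)
  have ml: "blinfun_apply l (a * b) = blinfun_apply l a * b" for a b
    using LIMSEQ_unique[OF la[of "a * b"]] tendsto_mult[OF la[of a] tendsto_const[of b]]
    by (simp add: left_mult_times)
  have mr: "blinfun_apply r (a * b) = a * blinfun_apply r b" for a b
    using LIMSEQ_unique[OF ra[of "a * b"]] tendsto_mult[OF tendsto_const[of a] ra[of b]]
    by (simp add: right_mult_times)
  have mlr: "blinfun_apply r a * b = a * blinfun_apply l b" for a b
    using LIMSEQ_unique[OF tendsto_mult[OF ra[of a] tendsto_const[of b]]]
      tendsto_mult[OF tendsto_const[of a] la[of b]]
    by (simp add: right_left_mult)
  have dc: "double_centralizer (blinfun_apply l) (blinfun_apply r)"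
    by (simp add: double_centralizer_def bounded_clinear_def blinfun.bounded_linear_right
        scl scr ml mr mlr)
  define x where "x = Abs_multiplier (blinfun_apply l, blinfun_apply r)"
  have x: "left_mult x = blinfun_apply l"
    by (simp add: x_def left_mult_Abs[OF dc])
  have nx: "norm (X k - x) \<le> norm (L k - l)" for k
    using norm_blinfun[of "L k - l"]
    by (intro norm_multiplier_bound norm_ge_zero) (simp add: x blinfun.diff_left L)
  have "X \<longlonglongrightarrow> x"
  proof (rule metric_LIMSEQ_I)
    fix e :: real
    assume "0 < e"
    then obtain N where "\<forall>k\<ge>N. norm (L k - l) < e"
      using LIMSEQ_D[OF l] by blast
    then show "\<exists>N. \<forall>k\<ge>N. dist (X k) x < e"
      unfolding dist_multiplier_def by (meson nx le_less_trans)
  qed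
  then show "convergent X" by (rule convergentI)
qed

end

text \<open>
  The canonical embedding of \<open>A\<close> into its multiplier algebra is isometric (\<open>norm_embed\<close>), and by
  \<open>times_embed\<close> the product of a multiplier \<open>m\<close> and \<open>a\<close> is again in \<open>A\<close>, namely \<open>left_mult m a\<close>.
\<close>

definition multiplier_embed :: "'a::cstar_algebra \<Rightarrow> 'a multiplier" where
  "multiplier_embed a = Abs_multiplier (\<lambda>b. a * b, \<lambda>b. b * a)"

lemma double_centralizer_embed: "double_centralizer (\<lambda>b. a * b) (\<lambda>b::'a::cstar_algebra. b * a)"
  by (simp add: double_centralizer_def bounded_clinear_def bounded_linear_mult_right
      bounded_linear_mult_left mult.assoc scaleC_mult_left scaleC_mult_right)

lemma left_mult_embed [simp]: "left_mult (multiplier_embed a) b = a * b"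
  by (simp add: multiplier_embed_def left_mult_Abs[OF double_centralizer_embed])

lemma right_mult_embed [simp]: "right_mult (multiplier_embed a) b = b * a"
  by (simp add: multiplier_embed_def right_mult_Abs[OF double_centralizer_embed])

lemma times_embed: "m * multiplier_embed a = multiplier_embed (left_mult m a)"
  by (rule multiplier_eqI) (simp_all add: left_mult_times right_left_mult)

lemma norm_embed: "norm (multiplier_embed a) = norm a"
proof (rule antisym)
  show "norm (multiplier_embed a) \<le> norm a"
    by (rule norm_multiplier_bound) (simp_all add: norm_mult_ineq)
  have "norm a * norm a = norm (left_mult (multiplier_embed a) (adj a))"
    using cstar_identity[of "adj a"] by (simp add: adj_adj power2_eq_square)
  also have "\<dots> \<le> norm (multiplier_embed a) * norm a"
    using norm_left_mult_le[of "multiplier_embed a" "adj a"] by simp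
  finally show "norm a \<le> norm (multiplier_embed a)"
    by (cases "norm a = 0") (auto simp: norm_multiplier_nonneg)
qed


section \<open>Hilbert modules\<close>

locale hilbert_module =
  fixes act :: "'a::cstar_algebra \<Rightarrow> 'm::complex_banach \<Rightarrow> 'm"
    and ip :: "'m \<Rightarrow> 'm \<Rightarrow> 'a"
  assumes act_add_left: "act (a + b) x = act a x + act b x"
    and act_add_right: "act a (x + y) = act a x + act a y"
    and act_act: "act a (act b x) = act (a * b) x"
    and act_scaleC_left: "act (c *\<^sub>C a) x = c *\<^sub>C act a x"
    and act_scaleC_right: "act a (c *\<^sub>C x) = c *\<^sub>C act a x"
    and ip_add_left: "ip (x + y) z = ip x z + ip y z"
    and ip_scaleC_left: "ip (c *\<^sub>C x) y = c *\<^sub>C ip x y"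
    and ip_act_left: "ip (act a x) y = a * ip x y"
    and ip_adj: "ip x y = adj (ip y x)"
    and ip_positive: "positive_element (ip x x)"
    and ip_eq_zero: "ip x x = 0 \<longleftrightarrow> x = 0"
    \<comment> \<open>The norm of the Banach space \<open>'m\<close> is the one induced by the inner product.\<close>
    and norm_ip: "norm x = sqrt (norm (ip x x))"

definition full :: "('m \<Rightarrow> 'm \<Rightarrow> 'a::cstar_algebra) \<Rightarrow> bool" where
  "full ip \<longleftrightarrow> closure (cspan {ip x y | x y. True}) = UNIV"

definition bounded_module_map ::
  "('a::cstar_algebra \<Rightarrow> 'm::complex_banach \<Rightarrow> 'm) \<Rightarrow> ('m \<Rightarrow> 'm) \<Rightarrow> bool" where
  "bounded_module_map act T \<longleftrightarrow> bounded_clinear T \<and> (\<forall>a x. T (act a x) = act a (T x))"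

definition orthogonality_preserving ::
  "('m \<Rightarrow> 'm \<Rightarrow> 'a::cstar_algebra) \<Rightarrow> ('m \<Rightarrow> 'm) \<Rightarrow> bool" where
  "orthogonality_preserving ip T \<longleftrightarrow> (\<forall>x y. ip x y = 0 \<longrightarrow> ip (T x) (T y) = 0)"

end

theory Submission
  imports Defs
begin

text \<open>
  Let \<open>v\<close> be a unitary on the module and \<open>f\<close>, \<open>g\<close> absolutely convergent Fourier series with \<open>f g = 0\<close>. Then
  \<open>f(v) x\<close> and \<open>g(v) y\<close> are orthogonal, and so are their images under \<open>T\<close>. For \<open>f\<close>, \<open>g\<close> the rotations of
  \<open>\<bar>cos\<bar> \<plusminus> cos\<close>, comparing Fourier coefficients in the angle of rotation shows that the third difference
  of the bounded sequence \<open>\<langle>T v\<^sup>j x, T v\<^sup>j y\<rangle>\<close> vanishes, so the sequence is constant. Taking for \<open>v\<close> the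
  Cayley transform of a small rank one operator \<open>x \<mapsto> \<langle>x, z\<rangle> z\<close> and polarising in \<open>z\<close> gives
  \<open>\<langle>x, w\<rangle> \<langle>T z, T y\<rangle> = \<langle>T x, T w\<rangle> \<langle>z, y\<rangle>\<close>. Hence \<open>\<langle>x, y\<rangle> \<mapsto> \<langle>T x, T y\<rangle>\<close> extends to a central self-adjoint
  multiplier \<open>\<kappa>\<close>. Its negative part vanishes because \<open>a\<^sup>* a = - b\<^sup>* b\<close> implies \<open>a = 0\<close> in a C*-algebra.
\<close>

section \<open>Positivity in unital C*-algebras\<close>

text \<open>The hypothesis on \<open>T\<close> speaks only of orthogonal pairs, and a module may
  display few of them; two functions of one unitary with product zero manufacture them. Their
  coefficients must be absolutely summable, so that they can be applied to the unitary by
  norm-convergent series instead of spectral theory: the kinks of |cos| allow this, the jumps of an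
  indicator function would not. The decisive coefficient is the one at frequency 1. It pairs
  adjacent frequencies, one of which is odd; |cos| has only even frequencies and cos only 1 and -1,
  so four terms survive, with weights in the ratio 1 : -3 : 3 : -1.

  On the span of the inner products, <x, y> -> <T x, T y> is not visibly well defined, since a sum
  of inner products can vanish for hidden reasons. It is kept as a relation until a norm bound,
  independent of the way an element is written as a sum, turns it into a map.

  Positivity is built from the norm alone, with the binomial series in place of functional
  calculus.\<close>

class unital_cstar_algebra = cstar_algebra + monoid_mult

lemma adj_one [simp]: "adj (1::'a::unital_cstar_algebra) = 1"
  by (metis adj_adj adj_mult mult.left_neutral mult.right_neutral)

lemma norm_one_le: "norm (1::'a::unital_cstar_algebra) \<le> 1"
  using cstar_identity[of "1::'a"] by (cases "norm (1::'a) = 0") (auto simp: power2_eq_square)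

lemma norm_scaleR_one_le: "c \<ge> 0 \<Longrightarrow> norm (c *\<^sub>R (1::'a::unital_cstar_algebra)) \<le> c"
  using mult_left_mono[OF norm_one_le, of c] by simp

lemma norm_power_le_one:
  fixes h :: "'a::unital_cstar_algebra"
  assumes "norm h \<le> 1"
  shows "norm (h ^ n) \<le> 1"
proof (induction n)
  case (Suc n)
  have "norm (h * h ^ n) \<le> norm h * norm (h ^ n)" by (rule norm_mult_ineq)
  also have "\<dots> \<le> 1 * 1" by (intro mult_mono assms Suc) auto
  finally show ?case by simp
qed (simp add: norm_one_le)

lemma norm_selfadjoint_square: "adj k = k \<Longrightarrow> norm (k * k) = (norm (k::'a::cstar_algebra))\<^sup>2"
  using cstar_identity[of k] by simp

lemma adj_power: "adj h = h \<Longrightarrow> adj (h ^ n) = (h::'a::unital_cstar_algebra) ^ n"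
  by (induction n) (simp_all add: adj_mult power_commutes)

text \<open>This is a norm form of "the spectrum lies in [0, 2r]", and closure under sums is just
  the triangle inequality. Agreement with \<open>positive_element\<close> comes from
  \<open>pos_sqrt\<close> and \<open>pos_adj_mult\<close>.\<close>

definition pos :: "'a::unital_cstar_algebra \<Rightarrow> bool" where
  "pos a \<longleftrightarrow> adj a = a \<and> (\<exists>r\<ge>0. norm (r *\<^sub>R 1 - a) \<le> r)"

lemma pos_selfadjoint: "pos a \<Longrightarrow> adj a = a"
  by (simp add: pos_def)

lemma posI: "adj a = a \<Longrightarrow> norm (r *\<^sub>R 1 - a) \<le> r \<Longrightarrow> pos a"
  unfolding pos_def by (meson norm_ge_zero order_trans)

lemma pos_add: "pos a \<Longrightarrow> pos b \<Longrightarrow> pos (a + b)"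
proof -
  assume "pos a" "pos b"
  then obtain r s where rs: "norm (r *\<^sub>R 1 - a) \<le> r" "norm (s *\<^sub>R 1 - b) \<le> s"
    by (auto simp: pos_def)
  have "norm ((r + s) *\<^sub>R 1 - (a + b)) = norm ((r *\<^sub>R 1 - a) + (s *\<^sub>R 1 - b))"
    by (simp add: algebra_simps)
  also have "\<dots> \<le> r + s" using rs by (intro norm_triangle_mono)
  finally show ?thesis
    using \<open>pos a\<close> \<open>pos b\<close> by (intro posI) (auto simp: pos_def adj_add)
qed

lemma pos_scaleR: "pos a \<Longrightarrow> c \<ge> 0 \<Longrightarrow> pos (c *\<^sub>R a)"
proof -
  assume "pos a" "c \<ge> 0"
  then obtain r where r: "norm (r *\<^sub>R 1 - a) \<le> r" by (auto simp: pos_def)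
  have "norm ((c * r) *\<^sub>R 1 - c *\<^sub>R a) = c * norm (r *\<^sub>R 1 - a)"
    using \<open>c \<ge> 0\<close> by (simp flip: scaleR_scaleR scaleR_diff_right)
  also have "\<dots> \<le> c * r" using r \<open>c \<ge> 0\<close> by (rule mult_left_mono)
  finally show ?thesis
    using \<open>pos a\<close> by (intro posI) (auto simp: pos_def adj_scaleR)
qed

lemma pos_norm_diff: "adj a = a \<Longrightarrow> norm a \<le> c \<Longrightarrow> pos (c *\<^sub>R 1 - a)"
  by (rule posI[of _ c]) (simp_all add: adj_diff adj_scaleR)

text \<open>Supplies a nonzero radius, by which \<open>pos_sqrt\<close> divides.\<close>

lemma pos_large: "pos a \<Longrightarrow> \<exists>r>0. norm (r *\<^sub>R 1 - a) \<le> r"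
proof -
  assume "pos a"
  then obtain r where r: "r \<ge> 0" "norm (r *\<^sub>R 1 - a) \<le> r" by (auto simp: pos_def)
  have "norm ((r + 1) *\<^sub>R 1 - a) = norm ((r *\<^sub>R 1 - a) + 1 *\<^sub>R 1)"
    by (simp add: algebra_simps)
  also have "\<dots> \<le> r + 1" using r norm_one_le by (intro norm_triangle_mono) auto
  finally show ?thesis using r(1) by (intro exI[of _ "r + 1"]) simp
qed

section \<open>The binomial series of sqrt(1 - t)\<close>

definition sqrt_coeff :: "nat \<Rightarrow> real" where
  "sqrt_coeff m = (-1) ^ m * ((1 / 2) gchoose m)"

lemma sqrt_coeff_0 [simp]: "sqrt_coeff 0 = 1"
  by (simp add: sqrt_coeff_def)

lemma sqrt_coeff_Suc: "2 * real (Suc m) * sqrt_coeff (Suc m) = (2 * real m - 1) * sqrt_coeff m"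
proof -
  have "(1/2::real) * ((1/2) gchoose m) =
      real m * ((1/2) gchoose m) + real (Suc m) * ((1/2) gchoose (Suc m))"
    by (rule gbinomial_mult_1)
  then have "2 * (real (Suc m) * ((1/2) gchoose (Suc m))) = (1 - 2 * real m) * ((1/2) gchoose m)"
    by (simp add: left_diff_distrib)
  then have "(-1) ^ Suc m * (2 * (real (Suc m) * ((1/2) gchoose (Suc m)))) =
      (-1) ^ Suc m * ((1 - 2 * real m) * ((1/2) gchoose m))"
    by (rule arg_cong)
  then show ?thesis
    unfolding sqrt_coeff_def power_Suc by (simp only: mult_ac mult_minus_left minus_mult_right) (simp add: algebra_simps)
qed

lemma sqrt_coeff_nonpos: "sqrt_coeff (Suc m) \<le> 0"
proof (induction m)
  case 0
  show ?case using sqrt_coeff_Suc[of 0] by simp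
next
  case (Suc m)
  have "2 * real (Suc (Suc m)) * sqrt_coeff (Suc (Suc m)) \<le> 0"
    unfolding sqrt_coeff_Suc[of "Suc m"] using Suc by (intro mult_nonneg_nonpos) auto
  then show ?case by (simp add: mult_le_0_iff)
qed

lemma sqrt_coeff_sum: "(\<Sum>m\<le>n. sqrt_coeff m) = (1 - 2 * real n) * sqrt_coeff n"
proof (induction n)
  case (Suc n)
  have "(\<Sum>m\<le>Suc n. sqrt_coeff m) = - ((2 * real n - 1) * sqrt_coeff n) + sqrt_coeff (Suc n)"
    using Suc by (simp add: algebra_simps)
  also have "\<dots> = (1 - 2 * real (Suc n)) * sqrt_coeff (Suc n)"
    unfolding sqrt_coeff_Suc[symmetric] by (simp add: algebra_simps)
  finally show ?case .
qed simp

lemma sqrt_coeff_sum_nonneg: "(\<Sum>m\<le>n. sqrt_coeff m) \<ge> 0"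
  unfolding sqrt_coeff_sum
proof (cases n)
  case (Suc m)
  then show "0 \<le> (1 - 2 * real n) * sqrt_coeff n"
    using sqrt_coeff_nonpos[of m] by (auto intro!: mult_nonpos_nonpos)
qed simp

text \<open>All coefficients after the first are nonpositive while the partial sums stay
  nonnegative, so their absolute values cannot exceed the leading 1. The series thus converges
  absolutely up to norm 1, boundary included.\<close>

lemma sqrt_coeff_abs_sum: "(\<Sum>m<n. \<bar>sqrt_coeff (Suc m)\<bar>) \<le> 1"
proof -
  have "(\<Sum>m\<le>n. sqrt_coeff m) = 1 + (\<Sum>m<n. sqrt_coeff (Suc m))"
    by (simp add: sum.atMost_shift)
  also have "(\<Sum>m<n. sqrt_coeff (Suc m)) = - (\<Sum>m<n. \<bar>sqrt_coeff (Suc m)\<bar>)"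
    by (simp add: sqrt_coeff_nonpos abs_of_nonpos sum_negf)
  finally show ?thesis using sqrt_coeff_sum_nonneg[of n] by simp
qed

lemma sqrt_coeff_summable: "summable (\<lambda>m. \<bar>sqrt_coeff (Suc m)\<bar>)"
proof (rule bounded_imp_summable)
  show "(\<Sum>m\<le>n. \<bar>sqrt_coeff (Suc m)\<bar>) \<le> 1" for n
    unfolding lessThan_Suc_atMost[symmetric] by (rule sqrt_coeff_abs_sum)
qed simp

text \<open>The square of the series is 1 - t, by Vandermonde's identity for 1/2 + 1/2 = 1.\<close>

lemma sqrt_coeff_convolution:
  "(\<Sum>i\<le>m. sqrt_coeff i * sqrt_coeff (m - i)) = (if m = 0 then 1 else if m = 1 then -1 else 0)"
proof -
  have "(\<Sum>i\<le>m. sqrt_coeff i * sqrt_coeff (m - i)) =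
      (-1) ^ m * (\<Sum>i\<le>m. ((1/2::real) gchoose i) * ((1/2) gchoose (m - i)))"
    unfolding sum_distrib_left
    by (intro sum.cong refl) (auto simp: sqrt_coeff_def simp flip: power_add)
  also have "(\<Sum>i\<le>m. ((1/2::real) gchoose i) * ((1/2) gchoose (m - i))) = 1 gchoose m"
    using gbinomial_Vandermonde[of "1/2::real" "1/2" m] by (simp add: atMost_atLeast0)
  also have "(1::real) gchoose m = of_nat (1 choose m)"
    by (simp add: binomial_gbinomial)
  finally show ?thesis
    by (cases m; cases "m - 1") auto
qed

lemma one_minus_has_sqrt:
  fixes h :: "'a::unital_cstar_algebra"
  assumes h: "adj h = h" "norm h \<le> 1"
  shows "\<exists>s. adj s = s \<and> s * s = 1 - h \<and> norm (1 - s) \<le> 1 \<and> (\<forall>b. h * b = b * h \<longrightarrow> s * b = b * s)"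
proof -
  define f where "f m = sqrt_coeff m *\<^sub>R h ^ m" for m
  have nf: "norm (f (Suc m)) \<le> \<bar>sqrt_coeff (Suc m)\<bar>" for m
    using mult_left_mono[OF norm_power_le_one[OF h(2)], of "\<bar>sqrt_coeff (Suc m)\<bar>" "Suc m"]
    by (simp add: f_def del: power_Suc)
  have sumS: "summable (\<lambda>m. norm (f (Suc m)))"
    by (rule summable_comparison_test'[OF sqrt_coeff_summable, of 0]) (simp add: nf)
  then have sumn: "summable (\<lambda>m. norm (f m))" by (rule iffD1[OF summable_Suc_iff])
  then have sum: "summable f" by (rule summable_norm_cancel)
  define s where "s = suminf f"
  have fs: "f sums s" unfolding s_def using sum by (rule summable_sums)
  have "adj s = s"
  proof -
    have "(\<lambda>m. adj (f m)) sums adj s"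
      by (rule bounded_linear.sums[OF bounded_linear_adj fs])
    moreover have "adj (f m) = f m" for m by (simp add: f_def adj_scaleR adj_power[OF h(1)])
    ultimately show ?thesis using fs sums_unique2[of f] by simp
  qed
  moreover have "s * s = 1 - h"
  proof -
    have "(\<lambda>m. \<Sum>i\<le>m. f i * f (m - i)) sums (s * s)"
      unfolding s_def by (rule Cauchy_product_sums[OF sumn sumn])
    moreover have "(\<Sum>i\<le>m. f i * f (m - i)) = (if m = 0 then 1 else if m = 1 then - h else 0)" for m
    proof -
      have "(\<Sum>i\<le>m. f i * f (m - i)) = (\<Sum>i\<le>m. (sqrt_coeff i * sqrt_coeff (m - i)) *\<^sub>R h ^ m)"
        by (intro sum.cong refl) (auto simp: f_def simp flip: power_add)
      also have "\<dots> = (\<Sum>i\<le>m. sqrt_coeff i * sqrt_coeff (m - i)) *\<^sub>R h ^ m"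
        by (simp add: scaleR_sum_left)
      finally show ?thesis by (simp add: sqrt_coeff_convolution)
    qed
    ultimately have "(\<lambda>m. if m = 0 then 1 else if m = 1 then - h else 0) sums (s * s)"
      by simp
    moreover have "(\<lambda>m. if m = 0 then 1 else if m = 1 then - h else 0) sums
        (\<Sum>m\<in>{0,1::nat}. if m = 0 then 1 else if m = 1 then - h else 0)"
      by (rule sums_finite) auto
    ultimately show ?thesis using sums_unique2[of "\<lambda>m. if m = 0 then 1 else if m = 1 then - h else 0"]
      by simp
  qed
  \<comment> \<open>This bound is what makes the root positive, through \<open>posI\<close> at
    radius 1.\<close>
  moreover have "norm (1 - s) \<le> 1"
  proof -
    have "(\<lambda>m. f (Suc m)) sums (s - f 0)" using fs by (simp add: sums_Suc_iff)
    then have "norm (s - f 0) \<le> (\<Sum>m. norm (f (Suc m)))"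
      using summable_norm[OF sumS] by (simp add: sums_iff)
    also have "\<dots> \<le> (\<Sum>m. \<bar>sqrt_coeff (Suc m)\<bar>)"
      by (rule suminf_le[OF nf sumS sqrt_coeff_summable])
    also have "\<dots> \<le> 1"
      by (rule suminf_le_const[OF sqrt_coeff_summable sqrt_coeff_abs_sum])
    finally show ?thesis by (simp add: f_def norm_minus_commute)
  qed
  moreover have "s * b = b * s" if "h * b = b * h" for b
  proof -
    have p: "h ^ m * b = b * h ^ m" for m
      by (induction m) (simp_all add: mult.assoc, metis mult.assoc that)
    have "(\<lambda>m. f m * b) sums (s * b)" "(\<lambda>m. b * f m) sums (b * s)"
      using sums_mult2[OF fs] sums_mult[OF fs] .
    moreover have "f m * b = b * f m" for m by (simp add: f_def p)
    ultimately show ?thesis using sums_unique2[of "\<lambda>m. b * f m"] by simp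
  qed
  ultimately show ?thesis by blast
qed

section \<open>Roots, squares and norm bounds of positive elements\<close>

lemma pos_sqrt:
  fixes a :: "'a::unital_cstar_algebra"
  assumes "pos a"
  obtains s where "pos s" "s * s = a" "\<And>b. a * b = b * a \<Longrightarrow> s * b = b * s"
proof -
  obtain r where r: "r > 0" "norm (r *\<^sub>R 1 - a) \<le> r" using pos_large[OF assms] by blast
  \<comment> \<open>Rescaling by the radius brings \<open>a\<close> into the form 1 -
    \<open>h\<close> with \<open>h\<close> of norm at most 1.\<close>
  define h where "h = 1 - (1 / r) *\<^sub>R a"
  have "h = (1 / r) *\<^sub>R (r *\<^sub>R 1 - a)" using r by (simp add: h_def algebra_simps)
  then have "norm h \<le> 1" using r by simp
  moreover have "adj h = h" using assms by (simp add: h_def adj_diff adj_scaleR pos_def)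
  ultimately obtain s where s: "adj s = s" "s * s = 1 - h" "norm (1 - s) \<le> 1"
    "\<And>b. h * b = b * h \<Longrightarrow> s * b = b * s"
    using one_minus_has_sqrt by metis
  show thesis
  proof
    show "pos (sqrt r *\<^sub>R s)"
      using s(1,3) r(1) by (intro pos_scaleR posI[of _ 1]) simp_all
    show "sqrt r *\<^sub>R s * sqrt r *\<^sub>R s = a"
      using s(2) r(1) by (simp add: h_def)
    show "(sqrt r *\<^sub>R s) * b = b * (sqrt r *\<^sub>R s)" if "a * b = b * a" for b
    proof -
      have "h * b = b * h" using that by (simp add: h_def algebra_simps)
      then show ?thesis using s(4) by simp
    qed
  qed
qed

text \<open>\<open>k + \<i> s\<close> is a multiple of a unitary.\<close>

lemma norm_le_of_sum_squares:
  fixes k s :: "'a::unital_cstar_algebra"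
  assumes "adj k = k" "adj s = s" "k * s = s * k" "k * k + s * s = c *\<^sub>R 1" "c \<ge> 0"
  shows "norm k \<le> sqrt c"
proof -
  define u where "u = k + \<i> *\<^sub>C s"
  have au: "adj u = k - \<i> *\<^sub>C s"
    using assms by (simp add: u_def adj_add adj_scaleC)
  have "adj u * u = k * k + s * s"
    unfolding au unfolding u_def
    by (simp add: algebra_simps scaleC_mult_left scaleC_mult_right scaleC_scaleC assms(3) scaleC_one)
  then have "(norm u)\<^sup>2 \<le> c"
    using cstar_identity[of u] norm_scaleR_one_le[OF assms(5), where 'a='a] assms(4) by simp
  then have nu: "norm u \<le> sqrt c" by (rule real_le_rsqrt)
  have "2 *\<^sub>R k = u + adj u" unfolding au by (simp add: u_def scaleR_2)
  then have "2 * norm k = norm (u + adj u)" by (metis norm_scaleR abs_numeral)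
  also have "\<dots> \<le> sqrt c + sqrt c" by (rule norm_triangle_mono) (simp_all add: nu)
  finally show ?thesis by simp
qed

text \<open>With \<open>c\<close> the squared norm of \<open>k\<close>, the root \<open>s\<close> of
  \<open>c\<close> - \<open>k\<close>^2 commutes with \<open>k\<close>, and the two squares add up
  to \<open>c\<close>. Here \<open>norm_le_of_sum_squares\<close> bounds \<open>s\<close> rather
  than \<open>k\<close>, and the squared norm of \<open>s\<close> is the norm of \<open>c\<close> -
  \<open>k\<close>^2.\<close>

lemma pos_square:
  fixes k :: "'a::unital_cstar_algebra"
  assumes k: "adj k = k"
  shows "pos (k * k)"
proof -
  define c where "c = (norm k)\<^sup>2"
  have kk: "adj (k * k) = k * k" by (simp add: adj_mult k)
  have "norm (k * k) \<le> c" by (simp add: c_def norm_selfadjoint_square k)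
  from pos_norm_diff[OF kk this] obtain s where
    s: "pos s" "s * s = c *\<^sub>R 1 - k * k" "\<And>b. (c *\<^sub>R 1 - k * k) * b = b * (c *\<^sub>R 1 - k * k) \<Longrightarrow> s * b = b * s"
    using pos_sqrt by blast
  have sk: "s * k = k * s" by (rule s(3)) (simp add: algebra_simps)
  have ss: "adj s = s" by (rule pos_selfadjoint[OF s(1)])
  have "norm s \<le> sqrt c"
    by (rule norm_le_of_sum_squares[OF ss k sk]) (simp_all add: s(2) c_def)
  then have "(norm s)\<^sup>2 \<le> c"
    by (metis c_def norm_ge_zero power_mono real_sqrt_pow2 zero_le_power2)
  then have "norm (c *\<^sub>R 1 - k * k) \<le> c"
    using norm_selfadjoint_square[OF ss] s(2) by simp
  then show ?thesis using kk by (intro posI)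
qed

text \<open>The roots of \<open>a\<close> and of its complement to \<open>c\<close> commute, and
  their squares add up to \<open>c\<close>.\<close>

lemma norm_le_of_pos:
  fixes a :: "'a::unital_cstar_algebra"
  assumes "pos a" "pos (c *\<^sub>R 1 - a)" "c \<ge> 0"
  shows "norm a \<le> c"
proof -
  obtain s where s: "pos s" "s * s = a" "\<And>b. a * b = b * a \<Longrightarrow> s * b = b * s"
    using pos_sqrt[OF assms(1)] by metis
  obtain t where t: "pos t" "t * t = c *\<^sub>R 1 - a"
    "\<And>b. (c *\<^sub>R 1 - a) * b = b * (c *\<^sub>R 1 - a) \<Longrightarrow> t * b = b * t"
    using pos_sqrt[OF assms(2)] by metis
  have "a * s = s * a" by (simp flip: s(2) add: mult.assoc)
  then have "t * s = s * t" by (intro t(3)) (simp add: algebra_simps)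
  then have "norm s \<le> sqrt c"
    using s(1,2) t(1,2) assms(3) by (intro norm_le_of_sum_squares[of s t]) (simp_all add: pos_selfadjoint)
  from power_mono[OF this norm_ge_zero, of 2] have "(norm s)\<^sup>2 \<le> c"
    using assms(3) by simp
  then show ?thesis
    using norm_selfadjoint_square[OF pos_selfadjoint[OF s(1)]] s(2) by simp
qed

lemma adj_half_parts:
  fixes x :: "'a::cstar_algebra"
  shows "\<exists>h k. adj h = h \<and> adj k = k \<and> x = h + \<i> *\<^sub>C k"
proof (intro exI conjI)
  let ?h = "(1/2) *\<^sub>C (x + adj x)" and ?k = "(- \<i> / 2) *\<^sub>C (x - adj x)"
  show "adj ?h = ?h" by (simp add: adj_scaleC adj_add adj_adj add.commute)
  show "adj ?k = ?k"
    by (simp add: adj_scaleC adj_diff adj_adj scaleC_diff)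
  show "x = ?h + \<i> *\<^sub>C ?k"
    by (simp add: scaleC_scaleC scaleC_add_right scaleC_diff)
       (simp flip: scaleC_add_left add: scaleC_one)
qed

text \<open>
  Writing \<open>p = - x\<^sup>* x\<close>, the element \<open>x x\<^sup>*\<close> is positive, and \<open>(R - x x\<^sup>*) x = x (R + p)\<close> bounds
  \<open>R\<^sup>2 p + 2 R p\<^sup>2 + p\<^sup>3\<close> by \<open>R\<^sup>2 \<parallel>p\<parallel>\<close>, which leaves no room for the quadratic term.
\<close>

lemma pos_minus_adj_mult_imp_zero:
  fixes x :: "'a::unital_cstar_algebra"
  assumes "pos (- (adj x * x))"
  shows "x = 0"
proof -
  define p where "p = - (adj x * x)"
  have p: "pos p" using assms by (simp add: p_def)
  then have sp: "adj p = p" by (rule pos_selfadjoint)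
  obtain h k where hk: "adj h = h" "adj k = k" "x = h + \<i> *\<^sub>C k" using adj_half_parts by blast
  have ax: "adj x = h - \<i> *\<^sub>C k" using hk by (simp add: adj_add adj_scaleC)
  \<comment> \<open>The two products in either order add up to 2 \<open>h\<close>^2 + 2
    \<open>k\<close>^2; the mixed terms cancel.\<close>
  have "x * adj x = 2 *\<^sub>R (h * h) + 2 *\<^sub>R (k * k) + p"
    unfolding p_def ax unfolding hk(3)
    by (simp add: algebra_simps scaleC_mult_left scaleC_mult_right scaleC_scaleC scaleR_2
        scaleC_one scaleC_diff)
  then have "pos (x * adj x)"
    using p hk by (simp add: pos_add pos_scaleR pos_square)
  then obtain R where R: "R > 0" "norm (R *\<^sub>R 1 - x * adj x) \<le> R" using pos_large by blast
  define g where "g = norm p"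
  have gx: "(norm x)\<^sup>2 = g" by (simp add: g_def p_def cstar_identity)
  define y where "y = x * (R *\<^sub>R 1 + p)"
  have "y = (R *\<^sub>R 1 - x * adj x) * x" by (simp add: y_def p_def algebra_simps)
  then have "norm y \<le> R * norm x"
    using norm_mult_ineq mult_right_mono[OF R(2), of "norm x"] by (metis norm_ge_zero order_trans)
  then have "(norm y)\<^sup>2 \<le> R\<^sup>2 * g"
    by (metis gx norm_ge_zero power_mono power_mult_distrib)
  moreover have "adj y * y = - (R\<^sup>2 *\<^sub>R p + (2 * R) *\<^sub>R (p * p) + p * p * p)"
  proof -
    have "adj y * y = (R *\<^sub>R 1 + p) * (adj x * x) * (R *\<^sub>R 1 + p)"
      by (simp add: y_def adj_mult adj_add adj_scaleR sp mult.assoc)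
    also have "adj x * x = - p" by (simp add: p_def)
    finally have y: "adj y * y = (R *\<^sub>R 1 + p) * - p * (R *\<^sub>R 1 + p)" .
    have R2: "(2 * R) *\<^sub>R (p * p) = R *\<^sub>R (p * p) + R *\<^sub>R (p * p)"
      unfolding mult_2 scaleR_add_left ..
    show ?thesis
      unfolding y R2 by (simp add: algebra_simps power2_eq_square)
  qed
  ultimately have n: "norm (R\<^sup>2 *\<^sub>R p + (2 * R) *\<^sub>R (p * p) + p * p * p) \<le> R\<^sup>2 * g"
    using cstar_identity[of y] by (simp only: norm_minus_cancel)
  have "adj (R\<^sup>2 *\<^sub>R p + (2 * R) *\<^sub>R (p * p) + p * p * p) = R\<^sup>2 *\<^sub>R p + (2 * R) *\<^sub>R (p * p) + p * p * p"
    by (simp add: adj_add adj_scaleR adj_mult sp mult.assoc)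
  from pos_norm_diff[OF this n]
  have 1: "pos ((R\<^sup>2 * g) *\<^sub>R 1 - (R\<^sup>2 *\<^sub>R p + (2 * R) *\<^sub>R (p * p) + p * p * p))" .
  have 2: "pos (p * p * p)"
  proof -
    obtain s where s: "pos s" "s * s = p" "\<And>b. p * b = b * p \<Longrightarrow> s * b = b * s"
      using pos_sqrt[OF p] by metis
    have "s * p = p * s" using s(3) by simp
    then have "(s * p) * (s * p) = p * p * p" "adj (s * p) = s * p"
      using s(2) pos_selfadjoint[OF s(1)] by (metis mult.assoc, simp add: adj_mult sp)
    then show ?thesis using pos_square by metis
  qed
  have "adj (p - g *\<^sub>R 1) = p - g *\<^sub>R 1" by (simp add: adj_diff adj_scaleR sp)
  then have "pos ((p - g *\<^sub>R 1) * (p - g *\<^sub>R 1))" by (rule pos_square)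
  then have 3: "pos ((2 * R) *\<^sub>R ((p - g *\<^sub>R 1) * (p - g *\<^sub>R 1)))" using R by (intro pos_scaleR) auto
  \<comment> \<open>Adding the multiple of (\<open>p\<close> - \<open>g\<close>)^2 replaces
    \<open>p\<close>^2 by its tangent bound 2 \<open>g\<close> \<open>p\<close> -
    \<open>g\<close>^2. The estimate becomes linear in \<open>p\<close>, so that
    \<open>norm_le_of_pos\<close> applies.\<close>
  have "pos ((R\<^sup>2 * g + 2 * R * g\<^sup>2) *\<^sub>R 1 - (R\<^sup>2 + 4 * R * g) *\<^sub>R p)"
  proof -
    have "(R\<^sup>2 * g + 2 * R * g\<^sup>2) *\<^sub>R 1 - (R\<^sup>2 + 4 * R * g) *\<^sub>R p =
        (R\<^sup>2 * g) *\<^sub>R 1 - (R\<^sup>2 *\<^sub>R p + (2 * R) *\<^sub>R (p * p) + p * p * p) + p * p * p +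
        (2 * R) *\<^sub>R ((p - g *\<^sub>R 1) * (p - g *\<^sub>R 1))"
    proof -
      have sq: "(p - g *\<^sub>R 1) * (p - g *\<^sub>R 1) = p * p - (2 * g) *\<^sub>R p + g\<^sup>2 *\<^sub>R 1"
        unfolding mult_2 scaleR_add_left by (simp add: algebra_simps power2_eq_square)
      show ?thesis unfolding sq by (simp add: algebra_simps power2_eq_square)
    qed
    then show ?thesis using pos_add[OF pos_add[OF 1 2] 3] by simp
  qed
  moreover have "pos ((R\<^sup>2 + 4 * R * g) *\<^sub>R p)"
    using R by (intro pos_scaleR p) (auto simp: g_def)
  ultimately have "norm ((R\<^sup>2 + 4 * R * g) *\<^sub>R p) \<le> R\<^sup>2 * g + 2 * R * g\<^sup>2"
    using R by (intro norm_le_of_pos) (auto simp: g_def)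
  moreover have "norm ((R\<^sup>2 + 4 * R * g) *\<^sub>R p) = (R\<^sup>2 + 4 * R * g) * g"
    using R by (simp add: g_def)
  ultimately have "2 * R * g\<^sup>2 \<le> 0" by (simp add: algebra_simps power2_eq_square)
  then have "g = 0" using R(1) by (simp add: mult_le_0_iff)
  then show ?thesis using gx by simp
qed

text \<open>The witness \<open>n\<close> is the negative part of \<open>a\<close>, and \<open>S\<close> is the root of its absolute value.\<close>

lemma selfadjoint_negative_part:
  fixes a :: "'a::unital_cstar_algebra"
  assumes a: "adj a = a"
  obtains n S where "adj n = n" "adj S = S" "a * n = - (n * n)" "n * a = a * n" "S * n = n * S"
    "n * n * n = (S * n) * (S * n)" "S * S = a + 2 *\<^sub>R n"
    "\<And>b. a * b = b * a \<Longrightarrow> n * b = b * n" "\<And>b. a * b = b * a \<Longrightarrow> S * b = b * S"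
proof -
  obtain K where K: "pos K" "K * K = a * a" "\<And>b. a * a * b = b * (a * a) \<Longrightarrow> K * b = b * K"
    using pos_sqrt[OF pos_square[OF a]] by metis
  obtain S where S: "pos S" "S * S = K" "\<And>b. K * b = b * K \<Longrightarrow> S * b = b * S"
    using pos_sqrt[OF K(1)] by metis
  have Ka: "K * a = a * K" by (rule K(3)) (simp add: mult.assoc)
  have Sa: "S * a = a * S" by (rule S(3)[OF Ka])
  have SK: "S * K = K * S" by (rule S(3)) simp
  define n where "n = (1/2) *\<^sub>R (K - a)"
  have an: "a * n = - (n * n)"
    unfolding n_def by (simp add: algebra_simps K(2) Ka) (simp flip: scaleR_add_left scaleR_diff_left)
  have Kn: "K * n = n * n"
    unfolding n_def by (simp add: algebra_simps K(2) Ka) (simp flip: scaleR_add_left scaleR_diff_left)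
  have Sn: "S * n = n * S" unfolding n_def by (simp add: algebra_simps Sa SK)
  show thesis
  proof
    show "adj n = n" "adj S = S"
      using pos_selfadjoint[OF K(1)] pos_selfadjoint[OF S(1)] a by (simp_all add: n_def adj_scaleR adj_diff)
    show "n * a = a * n" unfolding n_def by (simp add: algebra_simps Ka)
    show "n * n * n = (S * n) * (S * n)"
      by (metis Kn S(2) Sn mult.assoc)
    show "S * S = a + 2 *\<^sub>R n" by (simp add: S(2) n_def)
    fix b assume b: "a * b = b * a"
    then have "a * a * b = b * (a * a)" by (metis mult.assoc)
    then have Kb: "K * b = b * K" by (rule K(3))
    then show "n * b = b * n" unfolding n_def by (simp add: algebra_simps b)
    show "S * b = b * S" by (rule S(3)[OF Kb])
  qed (fact an Sn)+
qed

lemma selfadjoint_cube_eq_0: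
  fixes n :: "'a::cstar_algebra"
  assumes "adj n = n" "n * n * n = 0"
  shows "n = 0"
proof -
  have "norm ((n * n) * (n * n)) = (norm (n * n))\<^sup>2"
    by (rule norm_selfadjoint_square) (simp add: adj_mult assms)
  moreover have "(n * n) * (n * n) = 0" by (simp add: assms(2) flip: mult.assoc)
  ultimately have "norm (n * n) = 0" by simp
  then show ?thesis using norm_selfadjoint_square[OF assms(1)] by simp
qed

text \<open>For the negative part \<open>n\<close> of \<open>adj x * x\<close>, the element
  \<open>y = x * n\<close> satisfies \<open>adj y * y = - (n * n * n)\<close>. This is negative, so
  \<open>x * n\<close> vanishes, and with it \<open>n\<close>.\<close>

theorem pos_adj_mult:
  fixes x :: "'a::unital_cstar_algebra"
  shows "pos (adj x * x)"
proof -
  define a where "a = adj x * x"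
  have "adj a = a" by (simp add: a_def adj_mult adj_adj)
  then obtain n S where n: "adj n = n" "adj S = S" "a * n = - (n * n)" "n * a = a * n" "S * n = n * S"
    "n * n * n = (S * n) * (S * n)" "S * S = a + 2 *\<^sub>R n"
    using selfadjoint_negative_part[of a] by metis
  have nnn: "pos (n * n * n)"
    unfolding n(6) by (rule pos_square) (simp add: adj_mult n(1,2) n(5))
  have y: "adj (x * n) * (x * n) = - (n * n * n)"
  proof -
    have "adj (x * n) * (x * n) = n * (a * n)" by (simp add: adj_mult n(1) a_def mult.assoc)
    then show ?thesis by (simp add: n(3) mult.assoc)
  qed
  then have "x * n = 0" using nnn by (intro pos_minus_adj_mult_imp_zero) simp
  then have "n * n * n = 0" using y by simp
  then have "n = 0" by (rule selfadjoint_cube_eq_0[OF n(1)])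
  then have "a = S * S" using n(7) by simp
  then show ?thesis using pos_square[OF n(2)] by (simp add: a_def)
qed

lemma adj_mult_add_eq_0:
  fixes x y :: "'a::unital_cstar_algebra"
  assumes "adj x * x + adj y * y = 0"
  shows "x = 0"
proof (rule pos_minus_adj_mult_imp_zero)
  have "- (adj x * x) = adj y * y" using assms by (simp add: neg_eq_iff_add_eq_0)
  then show "pos (- (adj x * x))" by (simp add: pos_adj_mult)
qed

section \<open>The multiplier algebra provides the unit that \<open>pos\<close> requires\<close>

instantiation multiplier :: (cstar_algebra) unital_cstar_algebra
begin

definition "1 = Abs_multiplier (\<lambda>a. a, \<lambda>a. a)"

lemma double_centralizer_id: "double_centralizer (\<lambda>a. a) (\<lambda>a::'b::cstar_algebra. a)"
  by (simp add: double_centralizer_def bounded_clinear_def bounded_linear_ident)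

instance
proof
  fix m :: "'a multiplier"
  have "left_mult (1::'a multiplier) a = a" "right_mult (1::'a multiplier) a = a" for a
    by (simp_all add: one_multiplier_def left_mult_Abs right_mult_Abs double_centralizer_id)
  then show "1 * m = m" "m * 1 = m" by (auto intro!: multiplier_eqI)
qed

end

section \<open>Two absolutely summable Fourier series with product zero\<close>

lemma has_sum_shift:
  fixes f :: "int \<Rightarrow> 'a::{comm_monoid_add, topological_space}"
  shows "((\<lambda>k. f (k + n)) has_sum s) UNIV \<longleftrightarrow> (f has_sum s) UNIV"
  by (rule has_sum_reindex_bij_witness[of _ "\<lambda>k. k - n" "\<lambda>k. k + n"]) auto

text \<open>The terms with \<open>m\<close> >= 0 telescope to 1, the reflection \<open>m\<close> ->
  -2 - \<open>m\<close> carries them to those with \<open>m\<close> <= -2, and the term at -1 is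
  -2.\<close>

lemma has_sum_telescope:
  "((\<lambda>m. 1 / (2 * real_of_int m + 1) - 1 / (2 * real_of_int m + 3)) has_sum 0) UNIV"
proof -
  define d :: "int \<Rightarrow> real" where "d m = 1 / (2 * real_of_int m + 1) - 1 / (2 * real_of_int m + 3)" for m
  have "(\<lambda>n. - 1 / (2 * real (Suc n) + 1) - - 1 / (2 * real n + 1)) sums (0 - - 1 / (2 * real 0 + 1))"
    by (rule telescope_sums) real_asymp
  then have "(\<lambda>n. d (int n)) sums 1" by (simp add: d_def algebra_simps)
  then have nat: "((\<lambda>n. d (int n)) has_sum 1) UNIV"
    by (rule sums_nonneg_imp_has_sum) (simp add: d_def frac_le)
  have A: "(d has_sum 1) (range int)"
    by (subst has_sum_reindex) (use nat in \<open>auto simp: o_def inj_on_def\<close>)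
  have refl: "d (- 2 - m) = d m" for m
  proof -
    have *: "2 * real_of_int (- 2 - m) + 1 = - (2 * real_of_int m + 3)"
      "2 * real_of_int (- 2 - m) + 3 = - (2 * real_of_int m + 1)" by simp_all
    have "d (- 2 - m) = 1 / - (2 * real_of_int m + 3) - 1 / - (2 * real_of_int m + 1)"
      unfolding d_def * ..
    also have "\<dots> = d m" unfolding d_def divide_minus_right by simp
    finally show ?thesis .
  qed
  have B: "(d has_sum 1) (range (\<lambda>n. - 2 - int n))"
    by (subst has_sum_reindex) (use nat in \<open>auto simp: o_def inj_on_def refl\<close>)
  have C: "(d has_sum - 2) {-1}"
    by (rule has_sum_finiteI) (simp_all add: d_def)
  have "(d has_sum (1 + 1 + - 2)) (range int \<union> range (\<lambda>n. - 2 - int n) \<union> {-1})"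
    by (intro has_sum_Un_disjoint A B C) auto
  moreover have "range int \<union> range (\<lambda>n. - 2 - int n) \<union> {-1} = UNIV"
  proof -
    have "m \<in> range int \<union> range (\<lambda>n. - 2 - int n) \<union> {-1}" for m
    proof (cases "m \<ge> 0 \<or> m = -1")
      case False
      then have "m = - 2 - int (nat (- 2 - m))" by simp
      then show ?thesis by blast
    qed (auto intro: nonneg_int_cases)
    then show ?thesis by blast
  qed
  ultimately show ?thesis by (simp add: d_def[abs_def])
qed

definition sgn_coeff :: "int \<Rightarrow> real" where
  "sgn_coeff m = (-1) powi m / (2 * real_of_int m + 1)"

lemma odd_real_of_int_nonzero [simp]: "2 * real_of_int m + 1 \<noteq> 0"
proof -
  have "2 * m + 1 \<noteq> 0" by presburger
  then have "real_of_int (2 * m + 1) \<noteq> 0" by (simp only: of_int_eq_0_iff not_False_eq_True)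
  then show ?thesis by simp
qed

lemma minus_one_powi_mult_self [simp]: "(-1::real) powi m * (-1) powi m = 1"
  by (simp flip: power_int_mult_distrib)

lemma sgn_coeff_mult: "sgn_coeff m * sgn_coeff (m + n) =
  (-1) powi n / ((2 * real_of_int m + 1) * (2 * real_of_int (m + n) + 1))"
proof -
  have "(-1::real) powi m * (-1) powi (m + n) = (-1) powi n"
    by (simp add: power_int_add flip: mult.assoc)
  then show ?thesis unfolding sgn_coeff_def times_divide_times_eq by (simp only:)
qed

text \<open>By partial fractions the product is, up to a constant factor, 1 / (2m + 1) - 1 / (2(m +
  n) + 1), a sum of \<open>n\<close> shifted copies of the telescoping difference.\<close>

lemma sgn_coeff_correlation_pos:
  assumes "n > 0"
  shows "((\<lambda>m. sgn_coeff m * sgn_coeff (m + int n)) has_sum 0) UNIV"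
proof -
  define r where "r m = 1 / (2 * real_of_int m + 1)" for m
  have d: "((\<lambda>m. r (m + int i) - r (m + int i + 1)) has_sum 0) UNIV" for i
    using has_sum_telescope has_sum_shift[of "\<lambda>m. r m - r (m + 1)" "int i" 0]
    by (simp add: r_def algebra_simps)
  have "((\<lambda>m. r m - r (m + int k)) has_sum 0) UNIV" for k
  proof (induction k)
    case (Suc k)
    from has_sum_add[OF Suc d[of k]] show ?case by (simp add: algebra_simps)
  qed simp
  from has_sum_cmult_right[OF this, of "(-1) powi int n / (2 * real n)" n]
  have "((\<lambda>m. (-1) powi int n / (2 * real n) * (r m - r (m + int n))) has_sum 0) UNIV" by simp
  moreover have "(-1) powi int n / (2 * real n) * (r m - r (m + int n)) =
      sgn_coeff m * sgn_coeff (m + int n)" for m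
  proof -
    have "r m - r (m + int n) = 2 * real n / ((2 * real_of_int m + 1) * (2 * real_of_int (m + int n) + 1))"
      unfolding r_def by (subst diff_frac_eq) (simp_all del: of_int_add, simp)
    then show ?thesis using assms by (simp add: sgn_coeff_mult)
  qed
  ultimately show ?thesis by simp
qed

text \<open>In Fourier terms, the square of sgn cos is constant, so only the coefficient at 0
  survives. The value of \<open>c\<close> is pi^2 / 4.\<close>

lemma sgn_coeff_correlation:
  obtains c where "c > 0"
    "\<And>n. ((\<lambda>m. sgn_coeff m * sgn_coeff (m + n)) has_sum (if n = 0 then c else 0)) UNIV"
proof -
  have "(\<lambda>m. 1 / (2 * real_of_int m + 1) - 1 / (2 * real_of_int m + 3)) summable_on UNIV"
    using has_sum_telescope by (rule has_sum_imp_summable)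
  \<comment> \<open>With \<open>a\<close> = 2m + 1 the difference is 2 / (a (a + 2)); since |a + 2|
    <= 3 |a|, three times it dominates 1 / a^2.\<close>
  from summable_on_cmult_right[OF this, of 3]
  have "(\<lambda>m. norm (3 * (1 / (2 * real_of_int m + 1) - 1 / (2 * real_of_int m + 3)))) summable_on UNIV"
    by (rule iffD1[OF summable_on_iff_abs_summable_on_real])
  then have "(\<lambda>m. norm (sgn_coeff m * sgn_coeff m)) summable_on UNIV"
  proof (rule Infinite_Sum.abs_summable_on_comparison_test)
    fix m :: int
    define a where "a = 2 * real_of_int m + 1"
    have a0: "a \<noteq> 0" unfolding a_def by simp
    have a2: "a + 2 \<noteq> 0" using odd_real_of_int_nonzero[of "m + 1"] by (simp add: a_def algebra_simps)
    have "\<bar>a\<bar> \<ge> 1"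
    proof -
      have "\<bar>2 * m + 1\<bar> \<ge> 1" by presburger
      then have "real_of_int \<bar>2 * m + 1\<bar> \<ge> 1" by (simp only: of_int_1_le_iff)
      then show ?thesis by (simp add: a_def)
    qed
    then have a3: "\<bar>a + 2\<bar> \<le> 3 * \<bar>a\<bar>" by linarith
    have "sgn_coeff m * sgn_coeff m = 1 / (a * a)"
      using sgn_coeff_mult[of m 0] by (simp add: a_def)
    then have "norm (sgn_coeff m * sgn_coeff m) = 1 / (\<bar>a\<bar> * \<bar>a\<bar>)" by simp
    also have "\<dots> \<le> 6 / (\<bar>a\<bar> * \<bar>a + 2\<bar>)"
    proof -
      have "1 / (p * p) \<le> 6 / (p * q)" if "p > 0" "q > 0" "q \<le> 3 * p" for p q :: real
        using that by (simp add: field_simps)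
      from this[of "\<bar>a\<bar>" "\<bar>a + 2\<bar>"] show ?thesis using a0 a2 a3 by simp
    qed
    also have "\<dots> = norm (3 * (1 / a - 1 / (a + 2)))"
      using a0 a2 by (simp add: diff_frac_eq abs_mult)
    finally show "norm (sgn_coeff m * sgn_coeff m)
        \<le> norm (3 * (1 / (2 * real_of_int m + 1) - 1 / (2 * real_of_int m + 3)))"
      by (simp add: a_def add.assoc)
  qed
  then have "(\<lambda>m. sgn_coeff m * sgn_coeff m) summable_on UNIV"
    by (rule abs_summable_summable)
  then obtain c where c: "((\<lambda>m. sgn_coeff m * sgn_coeff m) has_sum c) UNIV"
    using summable_on_def by blast
  have "(\<Sum>m\<in>{0}. sgn_coeff m * sgn_coeff m) \<le> c"
    by (rule finite_sum_le_has_sum[OF c]) auto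
  then have "c > 0" by (simp add: sgn_coeff_def)
  moreover have "((\<lambda>m. sgn_coeff m * sgn_coeff (m + n)) has_sum (if n = 0 then c else 0)) UNIV" for n
  proof (cases n "0::int" rule: linorder_cases)
    case greater
    then show ?thesis using sgn_coeff_correlation_pos[of "nat n"] by simp
  next
    case less
    then have "((\<lambda>m. sgn_coeff m * sgn_coeff (m + - n)) has_sum 0) UNIV"
      using sgn_coeff_correlation_pos[of "nat (- n)"] by simp
    then have "((\<lambda>m. sgn_coeff (m + n) * sgn_coeff (m + n + - n)) has_sum 0) UNIV"
      by (subst has_sum_shift[of "\<lambda>m. sgn_coeff m * sgn_coeff (m + - n)"])
    then show ?thesis using less by (simp add: mult.commute)
  qed (simp add: c)
  ultimately show thesis using that by blast
qed

text \<open>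
  Up to the factor \<open>2 / \<pi>\<close> these are the Fourier coefficients of \<open>\<bar>cos\<bar>\<close>. The coefficients of
  \<open>sgn \<circ> cos\<close> are \<open>sgn_coeff\<close>, up to a factor and the indexing.
\<close>

definition abs_cos_coeff :: "int \<Rightarrow> real" where
  "abs_cos_coeff k = (if even k then (sgn_coeff (k div 2) + sgn_coeff (k div 2 - 1)) / 2 else 0)"

text \<open>|cos| is cos times sgn cos, and multiplication by cos averages the coefficients at the
  neighbouring frequencies 2m + 1 and 2m - 1.\<close>

lemma abs_cos_coeff_even: "abs_cos_coeff (2 * m) = (sgn_coeff m + sgn_coeff (m - 1)) / 2"
  by (simp add: abs_cos_coeff_def)

lemma has_sum_even:
  fixes f :: "int \<Rightarrow> 'a::{comm_monoid_add, topological_space}"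
  assumes "\<And>k. odd k \<Longrightarrow> f k = 0"
  shows "(f has_sum s) UNIV \<longleftrightarrow> ((\<lambda>m. f (2 * m)) has_sum s) UNIV"
proof -
  have "(f has_sum s) UNIV \<longleftrightarrow> (f has_sum s) (range (\<lambda>m. 2 * m))"
    by (rule has_sum_cong_neutral) (auto intro!: assms elim!: evenE)
  also have "\<dots> \<longleftrightarrow> ((\<lambda>m. f (2 * m)) has_sum s) UNIV"
    by (subst has_sum_reindex) (auto simp: o_def inj_on_def)
  finally show ?thesis .
qed

text \<open>The alternating signs turn the sum of two neighbouring terms into a difference 1 / (2m +
  1) - 1 / (2m - 1), which decays quadratically.\<close>

lemma abs_cos_coeff_summable: "abs_cos_coeff summable_on UNIV"
proof -
  have "(\<lambda>m. abs_cos_coeff (2 * m)) summable_on UNIV"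
  proof (rule abs_summable_summable, rule Infinite_Sum.abs_summable_on_comparison_test)
    define r where "r m = 1 / (2 * real_of_int m + 1) - 1 / (2 * real_of_int m + 3)" for m
    have "(\<lambda>m. r (m + - 1)) summable_on UNIV"
      unfolding summable_on_def has_sum_shift using has_sum_telescope by (auto simp: r_def[abs_def])
    then show "(\<lambda>m. norm (r (m + - 1))) summable_on UNIV"
      by (rule iffD1[OF summable_on_iff_abs_summable_on_real])
    show "norm (abs_cos_coeff (2 * m)) \<le> norm (r (m + - 1))" for m
    proof -
      have "abs_cos_coeff (2 * m) = (-1) powi m * ((1 / (2 * real_of_int m + 1) - 1 / (2 * real_of_int m - 1)) / 2)"
      proof -
        have "(-1::real) powi (m - 1) = - ((-1) powi m)" by (simp add: power_int_diff)
        moreover have "2 * real_of_int (m - 1) + 1 = 2 * real_of_int m - 1" by simp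
        ultimately have "sgn_coeff (m - 1) = - ((-1) powi m) / (2 * real_of_int m - 1)"
          unfolding sgn_coeff_def by (simp only:)
        moreover have "(p / x + - p / y) / 2 = p * ((1 / x - 1 / y) / 2)" for p x y :: real
          by (simp add: right_diff_distrib)
        ultimately show ?thesis
          unfolding abs_cos_coeff_even sgn_coeff_def[of m] by (simp only:)
      qed
      then have "norm (abs_cos_coeff (2 * m)) = \<bar>1 / (2 * real_of_int m + 1) - 1 / (2 * real_of_int m - 1)\<bar> / 2"
      proof -
        have "\<bar>(-1::real) powi m\<bar> = 1"
          by (simp only: power2_eq_square minus_one_powi_mult_self flip: abs_square_eq_1)
        then show ?thesis
          unfolding \<open>abs_cos_coeff (2 * m) = _\<close> real_norm_def abs_mult by (simp only: mult_1 abs_divide abs_numeral)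
      qed
      also have "\<dots> \<le> \<bar>1 / (2 * real_of_int m + 1) - 1 / (2 * real_of_int m - 1)\<bar>" by simp
      also have "\<dots> = norm (r (m + - 1))" by (simp add: r_def abs_minus_commute add.commute)
      finally show ?thesis .
    qed
  qed
  then show ?thesis
    unfolding summable_on_def by (subst has_sum_even) (auto simp: abs_cos_coeff_def)
qed

lemma abs_cos_coeff_minus: "abs_cos_coeff (- k) = abs_cos_coeff k"
proof -
  have q: "sgn_coeff (- m) = sgn_coeff (m - 1)" for m
  proof -
    have *: "2 * real_of_int (- m) + 1 = - (2 * real_of_int (m - 1) + 1)" by simp
    have "(-1::real) powi (- m) = (-1) powi m"
      unfolding power_int_minus by (rule inverse_unique) simp
    moreover have "(-1::real) powi (m - 1) = - ((-1) powi m)"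
      by (simp add: power_int_diff)
    ultimately show ?thesis unfolding sgn_coeff_def * by (simp only: divide_minus_right minus_divide_left)
  qed
  have "abs_cos_coeff (- (2 * m)) = abs_cos_coeff (2 * m)" for m
  proof -
    have "- (2 * m) div 2 = - m" "- m - 1 = - (m + 1)" by presburger+
    moreover have "sgn_coeff (- (m + 1)) = sgn_coeff m" using q[of "m + 1"] by (simp only: add_diff_cancel_right')
    ultimately show ?thesis using q[of m] by (simp add: abs_cos_coeff_def)
  qed
  then show ?thesis by (cases "even k") (auto elim!: evenE simp: abs_cos_coeff_def)
qed

text \<open>\<open>f\<close> and \<open>g\<close> are the coefficients of (pi / 2)(|cos| + cos) and
  (pi / 2)(|cos| - cos). The listed values determine every product \<open>f (k + 1) * g k\<close>:
  one of \<open>k\<close>, \<open>k + 1\<close> is odd, and 1 and -1 are the only odd frequencies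
  present.\<close>

lemma zero_product_coefficients:
  obtains f g :: "int \<Rightarrow> real" and s :: real where
    "s \<noteq> 0" "f summable_on UNIV" "g summable_on UNIV"
    "\<And>n. ((\<lambda>k. f (k + n) * g k) has_sum 0) UNIV"
    "f 1 = s" "f (-1) = s" "f 0 = 1" "f 2 = 1 / 3"
    "g 1 = - s" "g (-1) = - s" "g 0 = 1" "g (-2) = 1 / 3"
    "\<And>k. k \<notin> {-2, -1, 0, 1} \<Longrightarrow> f (k + 1) * g k = 0"
proof -
  obtain c where c: "c > 0"
    "\<And>n. ((\<lambda>m. sgn_coeff m * sgn_coeff (m + n)) has_sum (if n = 0 then c else 0)) UNIV"
    by (rule sgn_coeff_correlation) blast
  \<comment> \<open>The choice \<open>s\<close>^2 = \<open>c\<close> / 4 matches the square of cos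
    with that of |cos|; numerically \<open>s\<close> is pi / 4.\<close>
  define s where "s = sqrt c / 2"
  have s: "s > 0" "s * s = c / 4" using c(1) by (simp_all add: s_def)
  define t :: "int \<Rightarrow> real" where "t k = (if k = 1 \<or> k = -1 then s else 0)" for k
  note a = abs_cos_coeff_def
  \<comment> \<open>These are the coefficients of cos^2, supported at 0, 2 and -2. They expand into
    four correlations of \<open>sgn_coeff\<close>.\<close>
  have corr_even: "((\<lambda>k. abs_cos_coeff (k + 2 * N) * abs_cos_coeff k) has_sum
      (if N = 0 then c / 2 else if N = 1 \<or> N = -1 then c / 4 else 0)) UNIV" for N
  proof -
    let ?q = "\<lambda>m n. sgn_coeff m * sgn_coeff (m + n)"
    have "((\<lambda>m. (?q m N + ?q (m + - 1) N + ?q m (N - 1) + ?q (m + - 1) (N + 1)) / 4) has_sum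
        ((if N = 0 then c else 0) + (if N = 0 then c else 0) +
         (if N - 1 = 0 then c else 0) + (if N + 1 = 0 then c else 0)) / 4) UNIV"
      by (intro has_sum_divide_const has_sum_add c(2) iffD2[OF has_sum_shift[of "\<lambda>m. ?q m _"]])
    also have "(\<lambda>m. (?q m N + ?q (m + - 1) N + ?q m (N - 1) + ?q (m + - 1) (N + 1)) / 4) =
        (\<lambda>m. abs_cos_coeff (2 * m + 2 * N) * abs_cos_coeff (2 * m))"
    proof
      fix m
      have *: "2 * m + 2 * N = 2 * (m + N)" "m + - 1 = m - 1" "m - 1 + N = m + N - 1"
        "m + (N - 1) = m + N - 1" "m - 1 + (N + 1) = m + N" by simp_all
      show "(?q m N + ?q (m + - 1) N + ?q m (N - 1) + ?q (m + - 1) (N + 1)) / 4 =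
          abs_cos_coeff (2 * m + 2 * N) * abs_cos_coeff (2 * m)"
        unfolding * abs_cos_coeff_even by (simp add: distrib_left distrib_right mult.commute)
    qed
    also have "((if N = 0 then c else 0) + (if N = 0 then c else 0) +
         (if N - 1 = 0 then c else 0) + (if N + 1 = 0 then c else 0)) / 4 =
         (if N = 0 then c / 2 else if N = 1 \<or> N = -1 then c / 4 else 0)" by auto
    finally show ?thesis by (subst has_sum_even) (simp_all add: a)
  qed
  have corr_odd: "((\<lambda>k. abs_cos_coeff (k + n) * abs_cos_coeff k) has_sum 0) UNIV" if "odd n" for n
    by (rule has_sum_0) (use that in \<open>auto simp: a\<close>)
  have mix: "((\<lambda>k. abs_cos_coeff (k + n) * t k) has_sum
      s * (abs_cos_coeff (n + 1) + abs_cos_coeff (n - 1))) UNIV" for n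
    by (rule has_sum_finite_neutralI[of "{1, -1}"]) (auto simp: t_def algebra_simps)
  have mix': "((\<lambda>k. t (k + n) * abs_cos_coeff k) has_sum
      s * (abs_cos_coeff (n + 1) + abs_cos_coeff (n - 1))) UNIV" for n
    using abs_cos_coeff_minus[of "n + 1"] abs_cos_coeff_minus[of "n - 1"]
    by (intro has_sum_finite_neutralI[of "{1 - n, -1 - n}"]) (auto simp: t_def algebra_simps)
  have tt: "((\<lambda>k. t (k + n) * t k) has_sum s * (t (n + 1) + t (n - 1))) UNIV" for n
    by (rule has_sum_finite_neutralI[of "{1, -1}"]) (auto simp: t_def algebra_simps)
  show thesis
  proof
    have t: "t summable_on UNIV"
      by (rule finite_nonzero_values_imp_summable_on, rule finite_subset[of _ "{1, -1}"]) (auto simp: t_def)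
    show "(\<lambda>k. abs_cos_coeff k + t k) summable_on UNIV"
      by (intro summable_on_add abs_cos_coeff_summable t)
    show "(\<lambda>k. abs_cos_coeff k + - t k) summable_on UNIV"
      by (intro summable_on_add abs_cos_coeff_summable iffD2[OF summable_on_uminus] t)
    show "((\<lambda>k. (abs_cos_coeff (k + n) + t (k + n)) * (abs_cos_coeff k + - t k)) has_sum 0) UNIV" for n
    proof -
      have "((\<lambda>k. abs_cos_coeff (k + n) * abs_cos_coeff k) has_sum s * (t (n + 1) + t (n - 1))) UNIV"
      proof (cases "even n")
        case True
        then obtain N where N: "n = 2 * N" by (rule evenE)
        have "s * (t (n + 1) + t (n - 1)) = (if N = 0 then c / 2 else if N = 1 \<or> N = -1 then c / 4 else 0)"
          using s(2) by (auto simp: t_def N)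
        then show ?thesis using corr_even[of N] by (simp add: N)
      next
        case False
        then have "n + 1 \<noteq> 1" "n + 1 \<noteq> -1" "n - 1 \<noteq> 1" "n - 1 \<noteq> -1" by presburger+
        then have "t (n + 1) = 0" "t (n - 1) = 0" by (simp_all add: t_def)
        then show ?thesis using corr_odd[OF False] by simp
      qed
      \<comment> \<open>The autocorrelations of |cos| and cos agree, and the two mixed correlations
        agree by evenness, so everything cancels in pairs.\<close>
      from has_sum_add[OF has_sum_add[OF this mix'[of n]]
          has_sum_uminusI[OF has_sum_add[OF mix[of n] tt[of n]]]]
      show ?thesis by (simp add: algebra_simps)
    qed
    show "(abs_cos_coeff (k + 1) + t (k + 1)) * (abs_cos_coeff k + - t k) = 0"
      if "k \<notin> {-2, -1, 0, 1}" for k using that by (auto simp: t_def a)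
  qed (use s(1) in \<open>auto simp: t_def a sgn_coeff_def power_int_minus\<close>)
qed

section \<open>Maps preserving orthogonality of sesquilinear forms\<close>

lemma sum_root_of_unity_powers:
  fixes j :: int and N :: nat
  assumes "j \<noteq> 0" "\<bar>j\<bar> < int N"
  shows "(\<Sum>m<N. cis (2 * pi * real m / real N) powi j) = 0"
proof -
  have N: "N > 0" using assms by linarith
  define z where "z = cis (2 * pi * real_of_int j / real N)"
  have "cis (2 * pi * real m / real N) powi j = z ^ m" for m
    by (simp add: z_def Complex.DeMoivre cis_power_int mult_ac)
  moreover have "z ^ N = 1"
    using N by (simp add: z_def Complex.DeMoivre)
  moreover have "z \<noteq> 1"
  proof
    assume "z = 1"
    then obtain n :: int where "2 * pi * real_of_int j / real N = of_int (2 * n) * pi"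
      unfolding z_def cis_conv_exp exp_eq_1 by auto
    then have "real_of_int j = real_of_int (n * int N)" using N by (simp add: field_simps)
    then have "j = n * int N" by (simp only: of_int_eq_iff)
    moreover from this have "\<bar>n\<bar> \<ge> 1" using assms by auto
    ultimately have "\<bar>j\<bar> \<ge> int N" using mult_right_mono[of 1 "\<bar>n\<bar>" "int N"] by (simp add: abs_mult)
    then show False using assms by simp
  qed
  ultimately show ?thesis by (simp add: geometric_sum)
qed

text \<open>A large finite part of the series is uniformly small on the circle. Its mean against
  \<open>w\<close>^(-n) over the \<open>N\<close>-th roots of unity, with \<open>N\<close> above all
  |k - n|, isolates \<open>E n\<close>; this discrete mean replaces the Fourier integral.\<close>

lemma trigonometric_series_unique:
  fixes E :: "int \<Rightarrow> 'a::complex_banach"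
  assumes sum: "(\<lambda>n. norm (E n)) summable_on UNIV"
    and zero: "\<And>w. cmod w = 1 \<Longrightarrow> ((\<lambda>n. (w powi n) *\<^sub>C E n) has_sum 0) UNIV"
  shows "E n = 0"
proof -
  have "norm (E n) \<le> e" if e: "e > 0" for e
  proof -
    obtain F0 where F0: "finite F0" "dist (\<Sum>k\<in>F0. norm (E k)) (\<Sum>\<^sub>\<infinity>k. norm (E k)) \<le> e"
      using has_sum_finite_approximation[OF has_sum_infsum[OF sum] e] by blast
    define F where "F = insert n F0"
    have F: "finite F" "n \<in> F" using F0 by (auto simp: F_def)
    have sub: "(\<lambda>k. norm (E k)) summable_on (- F)" by (rule summable_on_subset_banach[OF sum]) simp
    have "(\<Sum>k\<in>F0. norm (E k)) \<le> (\<Sum>k\<in>F. norm (E k))"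
      by (rule sum_mono2) (auto simp: F_def F0)
    moreover have "(\<Sum>\<^sub>\<infinity>k\<in>F \<union> - F. norm (E k)) = (\<Sum>\<^sub>\<infinity>k\<in>F. norm (E k)) + (\<Sum>\<^sub>\<infinity>k\<in>-F. norm (E k))"
      by (rule infsum_Un_disjoint) (use F sub in auto)
    ultimately have tail: "(\<Sum>\<^sub>\<infinity>k\<in>-F. norm (E k)) \<le> e"
      using F0(2) F(1) by (simp add: dist_real_def)
    define P where "P w = (\<Sum>k\<in>F. (w powi k) *\<^sub>C E k)" for w
    have P: "norm (P w) \<le> e" if w: "cmod w = 1" for w
    proof -
      have nw: "norm ((w powi k) *\<^sub>C E k) = norm (E k)" for k
        by (simp add: norm_scaleC norm_power_int w)
      have s: "(\<lambda>k. norm ((w powi k) *\<^sub>C E k)) summable_on (- F)" using sub by (simp add: nw)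
      have "((\<lambda>k. (w powi k) *\<^sub>C E k) has_sum (P w + (\<Sum>\<^sub>\<infinity>k\<in>-F. (w powi k) *\<^sub>C E k))) (F \<union> - F)"
        using has_sum_infsum[OF abs_summable_summable[OF s]]
        by (intro has_sum_Un_disjoint) (auto simp: P_def F(1))
      then have "P w + (\<Sum>\<^sub>\<infinity>k\<in>-F. (w powi k) *\<^sub>C E k) = 0"
        using zero[OF w] by (simp add: has_sum_unique)
      then have "norm (P w) = norm (\<Sum>\<^sub>\<infinity>k\<in>-F. (w powi k) *\<^sub>C E k)"
        by (simp add: add_eq_0_iff)
      also have "\<dots> \<le> (\<Sum>\<^sub>\<infinity>k\<in>-F. norm ((w powi k) *\<^sub>C E k))" by (rule norm_infsum_bound[OF s])
      finally show ?thesis using tail by (simp add: nw)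
    qed
    define N where "N = Suc (nat (Max ((\<lambda>k. \<bar>k - n\<bar>) ` F)))"
    have N: "\<bar>k - n\<bar> < int N" if "k \<in> F" for k
    proof -
      have "\<bar>k - n\<bar> \<le> Max ((\<lambda>k. \<bar>k - n\<bar>) ` F)" using F that by (intro Max_ge) auto
      then show ?thesis by (simp add: N_def) linarith
    qed
    define w where "w m = cis (2 * pi * real m / real N)" for m
    have w: "w m \<noteq> 0" "cmod (w m) = 1" for m by (simp_all add: w_def)
    have "(\<Sum>m<N. (w m powi (- n)) *\<^sub>C P (w m)) = (\<Sum>k\<in>F. (\<Sum>m<N. w m powi (k - n)) *\<^sub>C E k)"
    proof -
      have "(w m powi (- n)) *\<^sub>C P (w m) = (\<Sum>k\<in>F. (w m powi (k - n)) *\<^sub>C E k)" for m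
        using w(1)[of m]
        by (simp add: P_def complex_vector.scale_sum_right scaleC_scaleC power_int_diff power_int_minus field_simps)
      then show ?thesis
        by (simp add: complex_vector.scale_sum_left) (rule sum.swap)
    qed
    also have "\<dots> = (\<Sum>k\<in>F. if k = n then of_nat N *\<^sub>C E n else 0)"
    proof (rule sum.cong[OF refl])
      fix k assume "k \<in> F"
      then show "(\<Sum>m<N. w m powi (k - n)) *\<^sub>C E k = (if k = n then of_nat N *\<^sub>C E n else 0)"
        using sum_root_of_unity_powers[of "k - n" N] N[of k] by (auto simp: w_def)
    qed
    also have "\<dots> = of_nat N *\<^sub>C E n" using F by simp
    finally have "of_nat N *\<^sub>C E n = (\<Sum>m<N. (w m powi (- n)) *\<^sub>C P (w m))" by simp
    then have "real N * norm (E n) = norm (\<Sum>m<N. (w m powi (- n)) *\<^sub>C P (w m))"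
      by (metis norm_scaleC norm_of_nat)
    also have "\<dots> \<le> (\<Sum>m<N. e)"
      by (rule sum_norm_le) (simp add: norm_scaleC norm_power_int w P)
    finally show ?thesis by (simp add: N_def)
  qed
  then have "norm (E n) \<le> 0" by (rule field_le_epsilon[of _ 0, simplified])
  then show ?thesis by simp
qed

section \<open>Sesquilinear forms evaluated on series of vectors\<close>

definition bounded_sesquilinear :: "('m::complex_banach \<Rightarrow> 'm \<Rightarrow> 'a::complex_banach) \<Rightarrow> bool" where
  "bounded_sesquilinear B \<longleftrightarrow> bounded_bilinear B \<and>
     (\<forall>c x y. B (c *\<^sub>C x) y = c *\<^sub>C B x y) \<and> (\<forall>c x y. B x (c *\<^sub>C y) = cnj c *\<^sub>C B x y)"

lemma has_sum_scaleC_right: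
  "(f has_sum s) A \<Longrightarrow> ((\<lambda>k. c *\<^sub>C (f k :: 'a::complex_banach)) has_sum c *\<^sub>C s) A"
  by (rule has_sum_bounded_linear[OF bounded_linear_scaleC])

text \<open>
  \<open>E n\<close> are the Fourier coefficients, as \<open>w\<close> runs through the unit circle, of the value of \<open>B\<close> at
  \<open>(\<Sum>j. f j w\<^sup>j X j, \<Sum>k. g k w\<^sup>k Y k)\<close>.
\<close>

lemma sesquilinear_series:
  fixes B :: "'m::complex_banach \<Rightarrow> 'm \<Rightarrow> 'a::complex_banach" and X Y :: "int \<Rightarrow> 'm" and f g :: "int \<Rightarrow> real"
  assumes B: "bounded_sesquilinear B"
    and f: "f summable_on UNIV" and g: "g summable_on UNIV"
    and X: "\<And>j. norm (X j) \<le> K" and Y: "\<And>j. norm (Y j) \<le> L"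
  defines "E \<equiv> \<lambda>n. \<Sum>\<^sub>\<infinity>k. (f (k + n) * g k) *\<^sub>R B (X (k + n)) (Y k)"
    and "\<xi> \<equiv> \<lambda>w. \<Sum>\<^sub>\<infinity>j. (f j *\<^sub>R (w powi j)) *\<^sub>C X j"
    and "\<eta> \<equiv> \<lambda>w. \<Sum>\<^sub>\<infinity>k. (g k *\<^sub>R (w powi k)) *\<^sub>C Y k"
  shows "\<And>n. ((\<lambda>k. (f (k + n) * g k) *\<^sub>R B (X (k + n)) (Y k)) has_sum E n) UNIV"
    and "(\<lambda>n. norm (E n)) summable_on UNIV"
    and "\<And>w. cmod w = 1 \<Longrightarrow> ((\<lambda>n. (w powi n) *\<^sub>C E n) has_sum B (\<xi> w) (\<eta> w)) UNIV"
proof -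
  interpret B: bounded_bilinear B using B by (simp add: bounded_sesquilinear_def)
  have Bl: "B (c *\<^sub>C x) y = c *\<^sub>C B x y" and Br: "B x (c *\<^sub>C y) = cnj c *\<^sub>C B x y" for c x y
    using B by (auto simp: bounded_sesquilinear_def)
  obtain M where M: "M \<ge> 0" "\<And>x y. norm (B x y) \<le> norm x * norm y * M"
    using B.nonneg_bounded by blast
  have KL: "K \<ge> 0" "L \<ge> 0" using norm_ge_zero order_trans X Y by blast+
  have BXY: "norm (B (X j) (Y k)) \<le> K * L * M" for j k
  proof -
    have "norm (B (X j) (Y k)) \<le> norm (X j) * norm (Y k) * M" by (rule M(2))
    also have "\<dots> \<le> K * L * M" by (intro mult_mono X Y M(1) mult_nonneg_nonneg KL) auto
    finally show ?thesis .
  qed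
  define F where "F = (\<lambda>(n, k). (f (k + n) * g k) *\<^sub>R B (X (k + n)) (Y k))"
  have "(\<lambda>j. norm (f j)) summable_on UNIV" "(\<lambda>k. norm (g k)) summable_on UNIV"
    using f g summable_on_iff_abs_summable_on_real by blast+
  then have "(\<lambda>p. norm (f (fst p) * g (snd p))) summable_on UNIV \<times> UNIV"
    unfolding Infinite_Sum.abs_summable_on_Sigma_iff
    by (auto simp: abs_mult infsum_cmult_right' intro!: summable_on_cmult_right summable_on_cmult_left)
  then have fg: "(\<lambda>(j, k). \<bar>f j * g k\<bar>) summable_on UNIV \<times> UNIV" by (simp add: case_prod_unfold)
  have fgn: "(\<lambda>p. \<bar>f (snd p + fst p) * g (snd p)\<bar>) summable_on UNIV \<times> UNIV"
  proof -
    have "(\<lambda>p. \<bar>f (snd p + fst p) * g (snd p)\<bar>) summable_on (UNIV \<times> UNIV) \<longleftrightarrow>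
        (\<lambda>(j, k). \<bar>f j * g k\<bar>) summable_on (UNIV \<times> UNIV)"
      by (rule summable_on_reindex_bij_witness[of _ "\<lambda>(j, k). (j - k, k)" "\<lambda>(n, k). (k + n, k)"]) auto
    then show ?thesis using fg by simp
  qed
  have nF: "(\<lambda>p. norm (F p)) summable_on UNIV \<times> UNIV"
  proof (rule Infinite_Sum.abs_summable_on_comparison_test)
    show "(\<lambda>p. norm (\<bar>f (snd p + fst p) * g (snd p)\<bar> * (K * L * M))) summable_on UNIV \<times> UNIV"
      using summable_on_cmult_left[OF fgn, of "K * L * M"] KL M(1) by (simp add: abs_mult)
    show "norm (F p) \<le> norm (\<bar>f (snd p + fst p) * g (snd p)\<bar> * (K * L * M))" for p
      using mult_left_mono[OF BXY, of "\<bar>f (snd p + fst p) * g (snd p)\<bar>"] KL M(1)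
      by (simp add: F_def case_prod_unfold abs_mult)
  qed
  note S = iffD1[OF Infinite_Sum.abs_summable_on_Sigma_iff nF]
  have nF1: "(\<lambda>k. norm (F (n, k))) summable_on UNIV" for n using S by auto
  have E_eq: "E n = (\<Sum>\<^sub>\<infinity>k. F (n, k))" for n by (simp add: E_def F_def)
  show E: "((\<lambda>k. (f (k + n) * g k) *\<^sub>R B (X (k + n)) (Y k)) has_sum E n) UNIV" for n
    using has_sum_infsum[OF abs_summable_summable[OF nF1[of n]]] by (simp add: E_def F_def)
  show "(\<lambda>n. norm (E n)) summable_on UNIV"
  proof (rule Infinite_Sum.abs_summable_on_comparison_test)
    show "(\<lambda>n. norm (\<Sum>\<^sub>\<infinity>k. norm (F (n, k)))) summable_on UNIV" using S by auto
    show "norm (E n) \<le> norm (\<Sum>\<^sub>\<infinity>k. norm (F (n, k)))" for n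
      unfolding E_eq using norm_infsum_bound[OF nF1[of n]] by (simp add: infsum_nonneg)
  qed
  fix w :: complex
  assume w: "cmod w = 1"
  have nw: "cmod (w powi j) = 1" for j using w by (simp add: norm_power_int)
  have w0: "w \<noteq> 0" using w by auto
  have cw: "w powi k * cnj w powi k = 1" for k
    using nw[of k] complex_norm_square[of "w powi k"] by simp
  have \<xi>: "((\<lambda>j. (f j *\<^sub>R (w powi j)) *\<^sub>C X j) has_sum \<xi> w) UNIV"
    unfolding \<xi>_def
  proof (rule has_sum_infsum, rule abs_summable_summable, rule Infinite_Sum.abs_summable_on_comparison_test)
    show "(\<lambda>j. norm (f j * K)) summable_on UNIV"
      by (rule iffD1[OF summable_on_iff_abs_summable_on_real summable_on_cmult_left[OF f]])
    show "norm ((f j *\<^sub>R (w powi j)) *\<^sub>C X j) \<le> norm (f j * K)" for j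
      using mult_left_mono[OF X, of "\<bar>f j\<bar>"] KL by (simp add: norm_scaleC nw abs_mult)
  qed
  have \<eta>: "((\<lambda>k. (g k *\<^sub>R (w powi k)) *\<^sub>C Y k) has_sum \<eta> w) UNIV"
    unfolding \<eta>_def
  proof (rule has_sum_infsum, rule abs_summable_summable, rule Infinite_Sum.abs_summable_on_comparison_test)
    show "(\<lambda>j. norm (g j * L)) summable_on UNIV"
      by (rule iffD1[OF summable_on_iff_abs_summable_on_real summable_on_cmult_left[OF g]])
    show "norm ((g j *\<^sub>R (w powi j)) *\<^sub>C Y j) \<le> norm (g j * L)" for j
      using mult_left_mono[OF Y, of "\<bar>g j\<bar>"] KL by (simp add: norm_scaleC nw abs_mult)
  qed
  \<comment> \<open>The substitution \<open>j\<close> = \<open>n\<close> + \<open>k\<close> turns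
    the double series sorted by frequency into the product of the two vector series. Conjugation in
    the second argument supplies the factor \<open>w\<close>^(-k).\<close>
  define H where "H = (\<lambda>(n, k). (w powi n) *\<^sub>C F (n, k))"
  have H: "H (j - k, k) = B ((f j *\<^sub>R (w powi j)) *\<^sub>C X j) ((g k *\<^sub>R (w powi k)) *\<^sub>C Y k)" for j k
    using w0 by (simp add: H_def F_def Bl Br scaleC_scaleC scaleR_scaleC cw power_int_diff power_int_minus
        scaleR_conv_of_real field_simps)
  have nH: "(\<lambda>p. norm (H p)) summable_on UNIV \<times> UNIV"
    using nF by (simp add: H_def case_prod_unfold norm_scaleC nw)
  have "H summable_on UNIV \<times> UNIV" by (rule abs_summable_summable[OF nH])
  then obtain s where s: "(H has_sum s) (UNIV \<times> UNIV)" using summable_on_def by blast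
  then have s': "((\<lambda>p. H (fst p - snd p, snd p)) has_sum s) (UNIV \<times> UNIV)"
    by (subst has_sum_reindex_bij_witness[of _ "\<lambda>(n, k). (k + n, k)" "\<lambda>(j, k). (j - k, k)"]) auto
  have "((\<lambda>n. (w powi n) *\<^sub>C E n) has_sum s) UNIV"
    by (rule has_sum_SigmaD[OF s]) (simp add: H_def F_def has_sum_scaleC_right[OF E])
  moreover have "s = B (\<xi> w) (\<eta> w)"
  proof -
    have "((\<lambda>j. B ((f j *\<^sub>R (w powi j)) *\<^sub>C X j) (\<eta> w)) has_sum s) UNIV"
      by (rule has_sum_SigmaD[OF s'])
        (simp add: H has_sum_bounded_linear[OF B.bounded_linear_right \<eta>])
    moreover have "((\<lambda>j. B ((f j *\<^sub>R (w powi j)) *\<^sub>C X j) (\<eta> w)) has_sum B (\<xi> w) (\<eta> w)) UNIV"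
      by (rule has_sum_bounded_linear[OF B.bounded_linear_left \<xi>])
    ultimately show ?thesis by (rule has_sum_unique)
  qed
  ultimately show "((\<lambda>n. (w powi n) *\<^sub>C E n) has_sum B (\<xi> w) (\<eta> w)) UNIV" by simp
qed

section \<open>Invariance under unitaries, from bounded sequences\<close>

lemma bounded_difference_constant:
  fixes h :: "int \<Rightarrow> 'a::real_normed_vector"
  assumes "\<And>j. norm (h j) \<le> C" and step: "\<And>j. h (j + 1) - h j = c"
  shows "c = 0"
proof (rule ccontr)
  assume "c \<noteq> 0"
  have "h (int n) = h 0 + real n *\<^sub>R c" for n
  proof (induction n)
    case (Suc n)
    then show ?case using step[of "int n"] by (simp add: algebra_simps)
  qed simp
  then have "norm (real n *\<^sub>R c) \<le> 2 * C" for n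
    using norm_triangle_ineq4[of "h (int n)" "h 0"] assms(1)[of "int n"] assms(1)[of 0] by simp
  then have "real n * norm c \<le> 2 * C" for n by simp
  then show False
    using \<open>c \<noteq> 0\<close> ex_less_of_nat_mult[of "norm c" "2 * C"] by (meson leD zero_less_norm_iff)
qed

lemma int_constant:
  assumes "\<And>j::int. h (j + 1) = h j"
  shows "h j = h 0"
proof (induction j rule: int_induct[of _ 0])
  case (step2 i)
  then show ?case using assms[of "i - 1"] by simp
qed (use assms in auto)

text \<open>The hypothesis is a rearranged third difference, so the second difference is constant.
  Boundedness of the first differences makes it 0; then the first difference is constant, and
  boundedness of \<open>h\<close> makes that 0 too.\<close>

lemma bounded_third_difference:
  fixes h :: "int \<Rightarrow> 'a::real_normed_vector"
  assumes bd: "\<And>j. norm (h j) \<le> C"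
    and third: "\<And>j. h (j + 1) - h (j - 2) = 3 *\<^sub>R (h j - h (j - 1))"
  shows "h (j + 1) = h j"
proof -
  define d e where "d j = h (j + 1) - h j" and "e j = d (j + 1) - d j" for j
  have nd: "norm (d j) \<le> 2 * C" for j
    using norm_triangle_ineq4[of "h (j + 1)" "h j"] bd[of j] bd[of "j + 1"] by (simp add: d_def)
  have "e (j + 1) = e j" for j
  proof -
    have "3 *\<^sub>R z = z + z + z" for z :: 'a
      using scaleR_add_left[of 2 1 z] by (simp add: scaleR_2)
    then show ?thesis using third[of "j + 2"] by (simp add: e_def d_def algebra_simps)
  qed
  then have "e j = e 0" for j by (rule int_constant)
  then have "d (j + 1) - d j = e 0" for j by (simp add: e_def)
  from bounded_difference_constant[of d, OF nd this] have "e 0 = 0" .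
  then have "d (j + 1) = d j" for j using \<open>\<And>j. d (j + 1) - d j = e 0\<close>[of j] by simp
  then have "d j = d 0" for j by (rule int_constant)
  then have "h (j + 1) - h j = d 0" for j by (simp add: d_def)
  from bounded_difference_constant[of h, OF bd this] have "d 0 = 0" .
  then show ?thesis using \<open>\<And>j. d j = d 0\<close>[of j] by (simp add: d_def)
qed

lemma orthogonality_third_difference:
  fixes B P :: "'m::complex_banach \<Rightarrow> 'm \<Rightarrow> 'a::complex_banach" and X Y :: "int \<Rightarrow> 'm"
  assumes B: "bounded_sesquilinear B" and P: "bounded_sesquilinear P"
    and orth: "\<And>x y. P x y = 0 \<Longrightarrow> B x y = 0"
    and X: "\<And>j. norm (X j) \<le> K" and Y: "\<And>j. norm (Y j) \<le> L"
    and inv: "\<And>j k. P (X (j + 1)) (Y (k + 1)) = P (X j) (Y k)"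
  shows "B (X 2) (Y 1) - B (X (-1)) (Y (-2)) = 3 *\<^sub>R (B (X 1) (Y 0) - B (X 0) (Y (-1)))"
proof -
  obtain f g :: "int \<Rightarrow> real" and s :: real where fg:
    "s \<noteq> 0" "f summable_on UNIV" "g summable_on UNIV"
    "\<And>n. ((\<lambda>k. f (k + n) * g k) has_sum 0) UNIV"
    "f 1 = s" "f (-1) = s" "f 0 = 1" "f 2 = 1 / 3"
    "g 1 = - s" "g (-1) = - s" "g 0 = 1" "g (-2) = 1 / 3"
    "\<And>k. k \<notin> {-2, -1, 0, 1} \<Longrightarrow> f (k + 1) * g k = 0"
    by (rule zero_product_coefficients, rule that)
  note SB = sesquilinear_series[where X = X and Y = Y, OF B fg(2,3) X Y] and SP = sesquilinear_series[where X = X and Y = Y, OF P fg(2,3) X Y]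
  define E where "E = (\<lambda>n. \<Sum>\<^sub>\<infinity>k. (f (k + n) * g k) *\<^sub>R B (X (k + n)) (Y k))"
  \<comment> \<open>By invariance \<open>P\<close> sees only the difference \<open>n\<close> of the
    indices. It factors out of the sum at frequency \<open>n\<close> and leaves the vanishing
    correlation of \<open>f\<close> and \<open>g\<close>.\<close>
  have PXY: "P (X (k + n)) (Y k) = P (X n) (Y 0)" for k n
    using int_constant[of "\<lambda>k. P (X (k + n)) (Y k)" k] inv[of "_ + n"] by (simp add: ac_simps)
  have P0: "(\<Sum>\<^sub>\<infinity>k. (f (k + n) * g k) *\<^sub>R P (X (k + n)) (Y k)) = 0" for n
  proof -
    have "((\<lambda>k. (f (k + n) * g k) *\<^sub>R P (X (k + n)) (Y k)) has_sum 0 *\<^sub>R P (X n) (Y 0)) UNIV"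
      unfolding PXY by (rule has_sum_bounded_linear[OF bounded_linear_scaleR_left fg(4)])
    then show ?thesis by (simp add: infsumI)
  qed
  have "((\<lambda>n. (w powi n) *\<^sub>C E n) has_sum 0) UNIV" if w: "cmod w = 1" for w
  proof -
    let ?x = "\<Sum>\<^sub>\<infinity>j. (f j *\<^sub>R (w powi j)) *\<^sub>C X j" and ?y = "\<Sum>\<^sub>\<infinity>k. (g k *\<^sub>R (w powi k)) *\<^sub>C Y k"
    have "((\<lambda>n. (w powi n) *\<^sub>C (0::'a)) has_sum P ?x ?y) UNIV"
      using SP(3)[OF w] unfolding P0 .
    then have "P ?x ?y = 0" by (simp add: scaleC_zero has_sum_unique[OF _ has_sum_0_simp])
    then have "B ?x ?y = 0" by (rule orth)
    then show ?thesis using SB(3)[OF w] by (simp add: E_def)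
  qed
  moreover have "(\<lambda>n. norm (E n)) summable_on UNIV" unfolding E_def by (rule SB(2))
  ultimately have "E 1 = 0" by (intro trigonometric_series_unique)
  then have 1: "((\<lambda>k. (f (k + 1) * g k) *\<^sub>R B (X (k + 1)) (Y k)) has_sum 0) UNIV"
    using SB(1)[of 1] by (simp add: E_def)
  have "((\<lambda>k. (f (k + 1) * g k) *\<^sub>R B (X (k + 1)) (Y k)) has_sum
      (\<Sum>k\<in>{-2, -1, 0, 1}. (f (k + 1) * g k) *\<^sub>R B (X (k + 1)) (Y k))) UNIV"
    by (rule has_sum_finite_neutralI[of "{-2, -1, 0, 1}"]) (use fg(13) in auto)
  then have "(\<Sum>k\<in>{-2, -1, 0, 1}. (f (k + 1) * g k) *\<^sub>R B (X (k + 1)) (Y k)) = 0"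
    using 1 by (rule has_sum_unique)
  then have "(s / 3) *\<^sub>R ((B (X (-1)) (Y (-2)) - B (X 2) (Y 1)) + 3 *\<^sub>R (B (X 1) (Y 0) - B (X 0) (Y (-1)))) = 0"
    by (simp add: fg(5-12) algebra_simps)
  then have "(B (X (-1)) (Y (-2)) - B (X 2) (Y 1)) + 3 *\<^sub>R (B (X 1) (Y 0) - B (X 0) (Y (-1))) = 0"
    using fg(1) by simp
  then show ?thesis by (simp add: algebra_simps)
qed

theorem orthogonality_preserving_invariant:
  fixes B P :: "'m::complex_banach \<Rightarrow> 'm \<Rightarrow> 'a::complex_banach"
  assumes B: "bounded_sesquilinear B" and P: "bounded_sesquilinear P"
    and orth: "\<And>x y. P x y = 0 \<Longrightarrow> B x y = 0"
    and v: "bij v" "\<And>x. norm (v x) = norm x" "\<And>x y. P (v x) (v y) = P x y"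
  shows "B (v x) (v y) = B x y"
proof -
  define X where "X z j = (if j \<ge> 0 then (v ^^ nat j) z else (inv v ^^ nat (- j)) z)" for z and j :: int
  have X: "X z (j + 1) = v (X z j)" for z j
  proof (cases "j \<ge> 0")
    case False
    then have "nat (- j) = Suc (nat (- (j + 1)))" by linarith
    then have "v (X z j) = (inv v ^^ nat (- (j + 1))) z"
      using False v(1) by (simp add: X_def bij_is_surj surj_f_inv_f)
    then show ?thesis using False by (cases "j = -1") (auto simp: X_def)
  qed (simp add: X_def nat_add_distrib)
  have X01: "X z 0 = z" "X z 1 = v z" for z by (simp_all add: X_def)
  have nX: "norm (X z j) = norm z" for z j
    using int_constant[of "\<lambda>j. norm (X z j)" j] by (simp add: X v(2) X01)
  obtain M where M: "\<And>x y. norm (B x y) \<le> norm x * norm y * M"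
    using B bounded_bilinear.bounded unfolding bounded_sesquilinear_def by blast
  \<comment> \<open>The index is offset by one: \<open>h (-1)\<close> is \<open>B x y\<close>, and
    \<open>h 0\<close> is \<open>B (v x) (v y)\<close>.\<close>
  define h where "h j = B (X x (j + 1)) (X y (j + 1))" for j
  have "h (-1 + 1) = h (-1)"
  proof (rule bounded_third_difference)
    show "norm (h j) \<le> norm x * norm y * M" for j
      unfolding h_def using M[of "X x (j + 1)" "X y (j + 1)"] by (simp add: nX)
    show "h (j + 1) - h (j - 2) = 3 *\<^sub>R (h j - h (j - 1))" for j
    proof -
      have "P (X x (i + 1 + j)) (X y (k + 1 + j + 1)) = P (X x (i + j)) (X y (k + j + 1))" for i k
        using X[of x "i + j"] X[of y "k + j + 1"] v(3) by (simp add: ac_simps)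
      \<comment> \<open>Frequency 1 pairs \<open>X (k + 1)\<close> with \<open>Y k\<close>; the
        additional shift by 1 in \<open>Y\<close> moves all four terms onto the diagonal sequence
        \<open>h\<close>.\<close>
      from orthogonality_third_difference[where X = "\<lambda>i. X x (i + j)" and Y = "\<lambda>i. X y (i + j + 1)",
          OF B P orth _ _ this, of "norm x" "norm y"]
      show ?thesis by (simp add: nX h_def algebra_simps)
    qed
  qed
  then show ?thesis by (simp add: h_def X01)
qed

section \<open>Hilbert modules\<close>

context hilbert_module
begin

lemma ip_add_right: "ip x (y + z) = ip x y + ip x z"
  by (metis adj_add ip_add_left ip_adj)

lemma ip_scaleC_right: "ip x (c *\<^sub>C y) = cnj c *\<^sub>C ip x y"
  by (metis adj_scaleC ip_scaleC_left ip_adj)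

lemma ip_act_right: "ip x (act a y) = ip x y * adj a"
  by (metis adj_mult ip_act_left ip_adj)

lemma ip_scaleR_left: "ip (r *\<^sub>R x) y = r *\<^sub>R ip x y"
  by (simp add: scaleR_scaleC ip_scaleC_left)

lemma ip_scaleR_right: "ip x (r *\<^sub>R y) = r *\<^sub>R ip x y"
  by (simp add: scaleR_scaleC ip_scaleC_right)

lemma ip_zero_right: "ip x 0 = 0"
  using ip_add_right[of x 0 0] by simp

lemma norm_ip_self: "norm (ip x x) = (norm x)\<^sup>2"
  by (simp add: norm_ip[of x])

lemma norm_ip_self_le: "norm x \<le> 1 \<Longrightarrow> norm y \<le> 1 \<Longrightarrow> cmod c = 1 \<Longrightarrow>
    norm (ip (x + c *\<^sub>C y) (x + c *\<^sub>C y)) \<le> 4"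
proof -
  assume *: "norm x \<le> 1" "norm y \<le> 1" "cmod c = 1"
  have "norm (x + c *\<^sub>C y) \<le> 1 + 1"
    using * by (intro norm_triangle_mono) (simp_all add: norm_scaleC)
  then show ?thesis
    using power_mono[of "norm (x + c *\<^sub>C y)" 2 2] by (simp add: norm_ip_self)
qed

lemma ip_polarization:
  "4 *\<^sub>C ip x y = (\<Sum>c\<in>{1, - 1, \<i>, - \<i>}. c *\<^sub>C ip (x + c *\<^sub>C y) (x + c *\<^sub>C y))"
proof -
  have *: "c *\<^sub>C ip (x + c *\<^sub>C y) (x + c *\<^sub>C y) = c *\<^sub>C (ip x x + (c * cnj c) *\<^sub>C ip y y) + (c * cnj c) *\<^sub>C ip x y + (c * c) *\<^sub>C ip y x" for c
    by (simp add: ip_add_left ip_add_right ip_scaleC_left ip_scaleC_right scaleC_add_right scaleC_scaleC mult_ac)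
  have "(\<Sum>c\<in>{1, - 1, \<i>, - \<i>}. c *\<^sub>C ip (x + c *\<^sub>C y) (x + c *\<^sub>C y)) =
      1 *\<^sub>C ip x y + 1 *\<^sub>C ip x y + 1 *\<^sub>C ip x y + 1 *\<^sub>C ip x y"
    unfolding * by (simp add: complex_eq_iff complex_vector.scale_minus_left scaleC_one)
  also have "\<dots> = (1 + 1 + 1 + 1) *\<^sub>C ip x y" by (simp only: scaleC_add_left)
  finally show ?thesis by simp
qed

text \<open>Polarisation on unit vectors replaces the Cauchy-Schwarz inequality: four terms of norm
  at most 4, divided by 4.\<close>

lemma norm_ip_le: "norm (ip x y) \<le> norm x * norm y * 4"
proof (cases "x = 0 \<or> y = 0")
  case True
  then show ?thesis
    using ip_zero_right ip_adj[of x y] ip_adj[of 0 y] by (metis adj_zero mult_zero_left mult_zero_right norm_zero order_refl)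
next
  case False
  define x' y' where "x' = (1 / norm x) *\<^sub>R x" and "y' = (1 / norm y) *\<^sub>R y"
  have n: "norm x' \<le> 1" "norm y' \<le> 1" by (simp_all add: x'_def y'_def)
  have "4 * norm (ip x' y') = norm (4 *\<^sub>C ip x' y')" by (simp add: norm_scaleC)
  also have "\<dots> \<le> (\<Sum>c\<in>{1, - 1, \<i>, - \<i>}. 4)"
    unfolding ip_polarization
    by (rule sum_norm_le) (auto simp only: norm_scaleC insert_iff norm_one norm_minus_cancel norm_ii mult_1 empty_iff
        intro!: norm_ip_self_le n)
  also have "\<dots> = 16" by (simp add: complex_eq_iff)
  finally have "norm (ip x' y') \<le> 4" by simp
  moreover have "ip x y = (norm x * norm y) *\<^sub>R ip x' y'"
    using False by (simp add: x'_def y'_def ip_scaleR_left ip_scaleR_right)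
  ultimately show ?thesis by (simp add: mult_left_mono)
qed

lemma bounded_sesquilinear_ip: "bounded_sesquilinear ip"
proof -
  have "bounded_bilinear ip"
    by standard (use norm_ip_le in \<open>auto simp: ip_add_left ip_add_right ip_scaleR_left ip_scaleR_right\<close>)
  then show ?thesis by (simp add: bounded_sesquilinear_def ip_scaleC_left ip_scaleC_right)
qed

lemma norm_act_le: "norm (act a x) \<le> norm a * norm x"
proof -
  have "(norm (act a x))\<^sup>2 = norm (a * ip x x * adj a)"
    by (simp add: ip_act_left ip_act_right mult.assoc flip: norm_ip_self)
  also have "\<dots> \<le> norm (a * ip x x) * norm (adj a)" by (rule norm_mult_ineq)
  also have "\<dots> \<le> norm a * norm (ip x x) * norm a"
    by (simp add: mult_right_mono norm_mult_ineq)
  also have "\<dots> = (norm a * norm x)\<^sup>2" by (simp add: norm_ip_self power2_eq_square)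
  finally show ?thesis by (rule power2_le_imp_le) simp
qed

text \<open>The Cayley transform \<open>(1 + \<i> u) (1 - \<i> u)\<^sup>-\<^sup>1\<close> of \<open>u\<close> is a unitary.\<close>

lemma orthogonality_preserving_selfadjoint:
  fixes B :: "'m \<Rightarrow> 'm \<Rightarrow> 'a"
  assumes B: "bounded_sesquilinear B" and orth: "\<And>x y. ip x y = 0 \<Longrightarrow> B x y = 0"
    and u: "bounded_clinear u" "\<And>x. norm (u x) \<le> q * norm x" "q < 1" "\<And>x y. ip (u x) y = ip x (u y)"
  shows "B (u x) y = B x (u y)"
proof -
  interpret u: bounded_linear u using u(1) by (simp add: bounded_clinear_def)
  define q' where "q' = max q 0"
  have q': "0 \<le> q'" "q' < 1" "norm (u x) \<le> q' * norm x" for x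
    using u(2)[of x] u(3) mult_right_mono[of q q' "norm x"] by (auto simp: q'_def)
  define p where "p c x = x + c *\<^sub>C u x" for c x
  \<comment> \<open>For \<open>c\<close> = i and -i these are the two factors of the Cayley
    transform; preimages are fixed points of a contraction.\<close>
  have bij: "bij (p c)" if c: "cmod c = 1" for c
  proof -
    have "\<exists>!x. p c x = y" for y
    proof -
      have "\<exists>!x. y - c *\<^sub>C u x = x"
      proof (rule banach_fix_type)
        show "\<forall>x z. dist (y - c *\<^sub>C u x) (y - c *\<^sub>C u z) \<le> q' * dist x z"
        proof (intro allI)
          fix x z
          have "(y - c *\<^sub>C u x) - (y - c *\<^sub>C u z) = c *\<^sub>C u (z - x)"
            by (simp add: u.diff scaleC_diff)
          then show "dist (y - c *\<^sub>C u x) (y - c *\<^sub>C u z) \<le> q' * dist x z"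
            using q'(3)[of "z - x"] by (simp add: dist_norm norm_scaleC c norm_minus_commute)
        qed
      qed (use q' in auto)
      then show ?thesis by (simp add: p_def algebra_simps eq_diff_eq) metis
    qed
    then show ?thesis by (metis bijI' )
  qed
  have expand: "S (p c x) (p c y) = S x y + cnj c *\<^sub>C S x (u y) + c *\<^sub>C S (u x) y + (c * cnj c) *\<^sub>C S (u x) (u y)"
    if "bounded_sesquilinear S" for S :: "'m \<Rightarrow> 'm \<Rightarrow> 'a" and c x y
  proof -
    interpret S: bounded_bilinear S using that by (simp add: bounded_sesquilinear_def)
    show ?thesis
      using that by (simp add: p_def bounded_sesquilinear_def S.add_left S.add_right scaleC_add_right
          scaleC_scaleC mult.commute add_ac)
  qed
  \<comment> \<open>Self-adjointness of \<open>u\<close> cancels the cross terms for either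
    sign.\<close>
  have ip_p: "ip (p \<i> x) (p \<i> y) = ip (p (- \<i>) x) (p (- \<i>) y)" for x y
    unfolding expand[OF bounded_sesquilinear_ip] by (simp add: u(4) complex_vector.scale_minus_left)
  define v where "v = p \<i> \<circ> inv (p (- \<i>))"
  have vp: "v (p (- \<i>) x) = p \<i> x" for x
    using bij[of "- \<i>"] by (simp add: v_def bij_is_inj)
  have surj: "\<exists>y. x = p (- \<i>) y" for x using bij[of "- \<i>"] by (metis bij_pointE norm_ii norm_minus_cancel)
  have bv: "bij v" unfolding v_def by (intro bij_comp bij_imp_bij_inv bij) simp_all
  have ipv: "ip (v x) (v y) = ip x y" for x y
    using surj[of x] surj[of y] by (auto simp: vp ip_p)
  then have "norm (v x) = norm x" for x by (simp add: norm_ip[of "v x"] norm_ip[of x])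
  from orthogonality_preserving_invariant[OF B bounded_sesquilinear_ip orth bv this ipv]
  have "B (v (p (- \<i>) x)) (v (p (- \<i>) y)) = B (p (- \<i>) x) (p (- \<i>) y)" .
  \<comment> \<open>The terms with no \<open>u\<close> or two are the same for both signs; only the
    cross terms remain, and they change sign with \<open>c\<close>.\<close>
  then have "\<i> *\<^sub>C (B (u x) y - B x (u y)) = - (\<i> *\<^sub>C (B (u x) y - B x (u y)))"
    unfolding vp expand[OF B] by (simp add: complex_vector.scale_minus_left scaleC_diff algebra_simps)
  then have "2 *\<^sub>R (\<i> *\<^sub>C (B (u x) y - B x (u y))) = 0" by (simp add: scaleR_2 eq_neg_iff_add_eq_0)
  then have "norm (\<i> *\<^sub>C (B (u x) y - B x (u y))) = 0" by simp
  then show ?thesis by (simp add: norm_scaleC del: norm_eq_zero) simp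
qed

lemma bounded_clinear_rank_one: "bounded_clinear (\<lambda>x. act (ip x z) z)"
proof -
  have "bounded_linear (\<lambda>x. act (ip x z) z)"
  proof (rule bounded_linear_intro)
    show "norm (act (ip x z) z) \<le> norm x * (norm z * 4 * norm z)" for x
      using norm_act_le[of "ip x z" z] mult_right_mono[OF norm_ip_le[of x z], of "norm z"]
      by (simp add: mult_ac)
  qed (simp_all add: ip_add_left act_add_left ip_scaleC_left act_scaleC_left scaleR_scaleC)
  then show ?thesis by (simp add: bounded_clinear_def ip_scaleC_left act_scaleC_left)
qed

end

lemma sesquilinear_diagonal_zero:
  fixes G :: "'m::complex_banach \<Rightarrow> 'm \<Rightarrow> 'a::complex_banach"
  assumes "\<And>x y z. G (x + y) z = G x z + G y z" "\<And>x y z. G x (y + z) = G x y + G x z"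
    "\<And>c x y. G (c *\<^sub>C x) y = c *\<^sub>C G x y" "\<And>c x y. G x (c *\<^sub>C y) = cnj c *\<^sub>C G x y"
    and diag: "\<And>z. G z z = 0"
  shows "G x y = 0"
proof -
  have 1: "G x y + G y x = 0"
    using diag[of "x + y"] by (simp add: assms(1-4) diag[of x] diag[of y] add.commute)
  have "\<i> *\<^sub>C (G y x - G x y) = 0"
    using diag[of "x + \<i> *\<^sub>C y"] by (simp add: assms(1-4) diag[of x] diag[of y] scaleC_diff complex_vector.scale_minus_left)
  then have "G y x = G x y" by simp
  then have "2 *\<^sub>R G x y = 0" using 1 by (simp add: scaleR_2)
  then show ?thesis by simp
qed

section \<open>The exchange identity for \<open>T\<close>\<close>

locale orthogonality_preserving_module_map = hilbert_module act ip
  for act :: "'a::cstar_algebra \<Rightarrow> 'm::complex_banach \<Rightarrow> 'm" and ip +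
  fixes T
  assumes T: "bounded_module_map act T" and orthT: "orthogonality_preserving ip T"
begin

lemma T_bounded_linear: "bounded_linear T"
  using T by (simp add: bounded_module_map_def bounded_clinear_def)

lemma T_simps: "T (x + y) = T x + T y" "T (c *\<^sub>C x) = c *\<^sub>C T x" "T (act a x) = act a (T x)"
  using T by (auto simp: bounded_module_map_def bounded_clinear_def linear_add bounded_linear.linear)

lemma bounded_sesquilinear_ipT: "bounded_sesquilinear (\<lambda>x y. ip (T x) (T y))"
proof -
  have "bounded_bilinear (\<lambda>x y. ip (T x) (T y))"
    using bounded_sesquilinear_ip T_bounded_linear
    by (auto simp: bounded_sesquilinear_def intro: bounded_bilinear.comp)
  then show ?thesis by (simp add: bounded_sesquilinear_def T_simps ip_scaleC_left ip_scaleC_right)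
qed

lemma ip_ipT_diagonal: "ip x z * ip (T z) (T y) = ip (T x) (T z) * ip z y"
proof -
  \<comment> \<open>Rescaling makes the rank one operator a strict contraction. Both sides of the
    claim are quadratic in \<open>z\<close>, so \<open>r\<close>^2 cancels at the end.\<close>
  define r where "r = 1 / (4 * (norm z + 1))"
  have r: "r > 0" unfolding r_def by (simp add: add_nonneg_pos)
  define z' where "z' = r *\<^sub>R z"
  have "norm z + 1 \<noteq> 0" using norm_ge_zero[of z] by linarith
  then have "r * (norm z + 1) = 1 / 4" by (simp add: r_def)
  then have "norm z' \<le> 1 / 4"
    using r by (simp add: z'_def distrib_left)
  then have nz: "norm z' * norm z' * 4 < 1"
    using mult_mono[of "norm z'" "1/4" "norm z'" "1/4"] by simp
  have "ip (T (act (ip x z') z')) (T y) = ip (T x) (T (act (ip y z') z'))"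
  proof (rule orthogonality_preserving_selfadjoint[OF bounded_sesquilinear_ipT _ bounded_clinear_rank_one _ nz])
    show "ip (T x) (T y) = 0" if "ip x y = 0" for x y
      using orthT that by (simp add: orthogonality_preserving_def)
    show "norm (act (ip x z') z') \<le> norm z' * norm z' * 4 * norm x" for x
      using norm_act_le[of "ip x z'" z'] mult_right_mono[OF norm_ip_le[of x z'], of "norm z'"]
      by (simp add: mult_ac)
    show "ip (act (ip x z') z') y = ip x (act (ip y z') z')" for x y
      by (simp add: ip_act_left ip_act_right flip: ip_adj)
  qed
  then have "ip x z' * ip (T z') (T y) = ip (T x) (T z') * ip z' y"
    by (simp add: T_simps ip_act_left ip_act_right flip: ip_adj)
  then show ?thesis
    using r by (simp add: z'_def T_simps(2) scaleR_scaleC ip_scaleC_left ip_scaleC_right scaleC_mult_left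
        scaleC_mult_right scaleC_scaleC)
qed

text \<open>With <T x, T y> read as \<open>\<kappa>\<close> <x, y>, this is (\<open>\<kappa>\<close>
  a) a' = a (\<open>\<kappa>\<close> a') for inner products, the seed of the double centralizer
  identity.\<close>

theorem ip_ipT: "ip x w * ip (T z) (T y) = ip (T x) (T w) * ip z y"
proof -
  define G where "G z w = ip x w * ip (T z) (T y) - ip (T x) (T w) * ip z y" for z w
  have "G z w = 0"
    by (rule sesquilinear_diagonal_zero)
      (simp_all add: G_def ip_add_left ip_add_right T_simps ip_scaleC_left ip_scaleC_right
        scaleC_mult_left scaleC_mult_right scaleC_diff ip_ipT_diagonal algebra_simps)
  then show ?thesis by (simp add: G_def)
qed

end

section \<open>The multiplier\<close>

lemma mult_embed: "multiplier_embed a * multiplier_embed b = multiplier_embed (a * b)"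
  by (simp add: times_embed)

lemma adj_embed: "adj (multiplier_embed a) = multiplier_embed (adj a)"
  by (rule multiplier_eqI) (simp_all add: left_mult_adj right_mult_adj adj_mult adj_adj)

lemma embed_eq_0_iff: "multiplier_embed a = 0 \<longleftrightarrow> a = 0"
  using norm_embed[of a] by (metis norm_eq_zero)

text \<open>Testing with \<open>c = adj (a - b)\<close> suffices, by the C*-identity; this stands in
  for an approximate unit.\<close>

lemma cstar_left_cancel:
  fixes a b :: "'a::cstar_algebra"
  assumes "\<And>c. a * c = b * c"
  shows "a = b"
proof -
  have "(a - b) * adj (a - b) = 0" using assms by (simp add: left_diff_distrib)
  then have "norm (adj (a - b)) = 0" using cstar_identity[of "adj (a - b)"] by (simp add: adj_adj)
  then show ?thesis by simp
qed

lemma cstar_right_cancel: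
  fixes a b :: "'a::cstar_algebra"
  assumes "\<And>c. c * a = c * b"
  shows "a = b"
proof -
  have "adj a * c = adj b * c" for c
    using assms[of "adj c"] by (metis adj_mult adj_adj)
  then have "adj a = adj b" by (rule cstar_left_cancel)
  then show ?thesis by (metis adj_adj)
qed

text \<open>By cancellation, \<open>L a * b = a * L b\<close> forces \<open>L\<close> to respect
  products on both sides, so that (\<open>L\<close>, \<open>L\<close>) is a double centralizer. The
  same identity carries it past any other multiplier.\<close>

lemma central_multiplier_exists:
  fixes L :: "'a::cstar_algebra \<Rightarrow> 'a"
  assumes L: "bounded_clinear L" "\<And>a b. L a * b = a * L b" "\<And>a. L (adj a) = adj (L a)"
  obtains \<kappa> where "\<kappa> \<in> centre" "adj \<kappa> = \<kappa>" "\<And>a. \<kappa> * multiplier_embed a = multiplier_embed (L a)"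
proof -
  have L1: "L (a * b) = L a * b" for a b
    by (rule cstar_left_cancel) (metis L(2) mult.assoc)
  have L2: "L (a * b) = a * L b" for a b using L1 L(2) by simp
  have dc: "double_centralizer L L"
    using L by (simp add: double_centralizer_def L1 L2[symmetric])
  define \<kappa> where "\<kappa> = Abs_multiplier (L, L)"
  have l: "left_mult \<kappa> = L" and r: "right_mult \<kappa> = L"
    by (simp_all add: \<kappa>_def left_mult_Abs[OF dc] right_mult_Abs[OF dc])
  show thesis
  proof
    show "\<kappa> \<in> centre"
      unfolding centre_def mem_Collect_eq
    proof (intro allI multiplier_eqI)
      fix m :: "'a multiplier" and a
      show "left_mult (\<kappa> * m) a = left_mult (m * \<kappa>) a"
      proof (rule cstar_left_cancel)
        fix c
        have "L (left_mult m a) * c = left_mult m (a * L c)" by (simp add: L(2) left_mult_times)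
        also have "\<dots> = left_mult m (L a) * c" by (simp add: left_mult_times flip: L(2))
        finally show "left_mult (\<kappa> * m) a * c = left_mult (m * \<kappa>) a * c" by (simp add: l)
      qed
      show "right_mult (\<kappa> * m) a = right_mult (m * \<kappa>) a"
      proof (rule cstar_right_cancel)
        fix c
        have "c * right_mult m (L a) = right_mult m (L c * a)" by (simp add: L(2) right_mult_times)
        also have "\<dots> = c * L (right_mult m a)" unfolding right_mult_times unfolding L(2) ..
        finally show "c * right_mult (\<kappa> * m) a = c * right_mult (m * \<kappa>) a" by (simp add: r)
      qed
    qed
    show "adj \<kappa> = \<kappa>"
      by (rule multiplier_eqI) (simp_all add: left_mult_adj right_mult_adj l r L(3) adj_adj)
    show "\<kappa> * multiplier_embed a = multiplier_embed (L a)" for a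
      by (simp add: times_embed l)
  qed
qed

text \<open>For positive \<open>d\<close> the powers (b / d)^(2^k) stay below C / a, so the base
  cannot exceed 1.\<close>

lemma le_if_iterated_square_powers_le:
  fixes b d C :: real
  assumes "0 < a" "0 \<le> d" and "\<And>k. a * b ^ (2 ^ k) \<le> C * d ^ (2 ^ k)"
  shows "b \<le> d"
proof (rule ccontr)
  assume "\<not> b \<le> d"
  then have bd: "d < b" "0 < b" using assms(2) by auto
  show False
  proof (cases "d = 0")
    case True
    then have "a * b ^ (2 ^ 0) \<le> 0" using assms(3)[of 0] by simp
    then show False using assms(1) bd by (simp add: mult_le_0_iff)
  next
    case False
    then have d: "d > 0" "b / d > 1" using assms(2) bd by auto
    obtain k where k: "C / a < (b / d) ^ k" using real_arch_pow[OF d(2)] by blast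
    also have "\<dots> \<le> (b / d) ^ (2 ^ k)"
      using d(2) by (intro power_increasing less_imp_le less_exp) auto
    finally have "C / a < b ^ (2 ^ k) / d ^ (2 ^ k)" by (simp add: power_divide)
    then have "C * d ^ (2 ^ k) < a * b ^ (2 ^ k)"
      using assms(1) d(1) by (simp add: field_simps)
    then show False using assms(3)[of k] by simp
  qed
qed

section \<open>The relation on the span of the inner products\<close>

locale full_orthogonality_preserving = orthogonality_preserving_module_map +
  assumes full: "full ip"
begin

text \<open>The graph of multiplication by \<open>\<kappa>\<close> on the linear span of the inner products.\<close>

inductive mult_rel :: "'a \<Rightarrow> 'a \<Rightarrow> bool" where
  zero: "mult_rel 0 0"
| add: "mult_rel a b \<Longrightarrow> mult_rel (ip x y + a) (ip (T x) (T y) + b)"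

lemma mult_rel_ip: "mult_rel (ip x y) (ip (T x) (T y))"
  using add[OF zero, of x y] by simp

lemma mult_rel_add: "mult_rel a b \<Longrightarrow> mult_rel a' b' \<Longrightarrow> mult_rel (a + a') (b + b')"
  by (induction rule: mult_rel.induct) (auto simp: add.assoc intro: mult_rel.intros)

text \<open>Scalars are absorbed into the left vector of each inner product; hence sums suffice to
  generate the relation.\<close>

lemma mult_rel_scaleC: "mult_rel a b \<Longrightarrow> mult_rel (c *\<^sub>C a) (c *\<^sub>C b)"
proof (induction rule: mult_rel.induct)
  case (add a b x y)
  then show ?case
    using mult_rel.add[OF add.IH, of "c *\<^sub>C x" y] by (simp add: scaleC_add_right ip_scaleC_left T_simps)
qed (simp add: scaleC_zero mult_rel.zero)

lemma mult_rel_diff: "mult_rel a b \<Longrightarrow> mult_rel a' b' \<Longrightarrow> mult_rel (a - a') (b - b')"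
  using mult_rel_add[OF _ mult_rel_scaleC[of a' b' "-1"], of a b]
  by (simp add: complex_vector.scale_minus_left scaleC_one)

lemma mult_rel_adj: "mult_rel a b \<Longrightarrow> mult_rel (adj a) (adj b)"
proof (induction rule: mult_rel.induct)
  case (add a b x y)
  then show ?case
    using mult_rel.add[OF add.IH, of y x] by (simp add: adj_add flip: ip_adj)
qed (simp add: mult_rel.zero)

lemma mult_rel_total_span: "a \<in> cspan {ip x y | x y. True} \<Longrightarrow> \<exists>b. mult_rel a b"
proof (induction rule: complex_vector.span_induct_alt)
  case base
  then show ?case using mult_rel.zero by blast
next
  case (step c z a)
  then obtain x y b where "z = ip x y" "mult_rel a b" by blast
  then have "mult_rel (c *\<^sub>C z + a) (c *\<^sub>C ip (T x) (T y) + b)"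
    by (intro mult_rel_add mult_rel_scaleC) (auto simp: mult_rel_ip)
  then show ?case by blast
qed

lemma mult_rel_swap:
  assumes "mult_rel a b" "mult_rel a' b'"
  shows "b * a' = a * b'"
  using assms(2)
proof (induction rule: mult_rel.induct)
  case (add a' b' z w)
  have "b * ip z w = a * ip (T z) (T w)"
    using assms(1) by (induction rule: mult_rel.induct) (simp_all add: distrib_right ip_ipT)
  then show ?case using add by (simp add: distrib_left)
qed simp

text \<open>\<open>s n\<close> stands for \<open>\<kappa>\<close>^n a and arises by replacing each
  <x, y> in \<open>a\<close> by <T^n x, T^n y>. The constant \<open>C\<close> depends on how
  \<open>a\<close> is written as a sum, but the rate \<open>K\<close>^2 does not.\<close>

lemma mult_rel_orbit:
  assumes K: "\<And>x. norm (T x) \<le> K * norm x" "K \<ge> 0" and "mult_rel a b"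
  shows "\<exists>s C. s 0 = a \<and> s (Suc 0) = b \<and> (\<forall>n. mult_rel (s n) (s (Suc n))) \<and>
    (\<forall>n. norm (s n) \<le> C * (K\<^sup>2) ^ n)"
  using assms(3)
proof (induction rule: mult_rel.induct)
  case zero
  then show ?case by (intro exI[of _ "\<lambda>_. 0"] exI[of _ 0]) (simp add: mult_rel.zero)
next
  case (add a b x y)
  then obtain s C where s: "s 0 = a" "s (Suc 0) = b" "\<And>n. mult_rel (s n) (s (Suc n))"
    "\<And>n. norm (s n) \<le> C * (K\<^sup>2) ^ n" by blast
  have Tn: "norm ((T ^^ n) x) \<le> K ^ n * norm x" for n x
  proof (induction n)
    case (Suc n)
    then show ?case
      using order_trans[OF K(1)[of "(T ^^ n) x"] mult_left_mono[OF Suc K(2)]] by (simp add: mult_ac)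
  qed simp
  define p where "p n = ip ((T ^^ n) x) ((T ^^ n) y)" for n
  have np: "norm (p n) \<le> (norm x * norm y * 4) * (K\<^sup>2) ^ n" for n
  proof -
    have "norm (p n) \<le> norm ((T ^^ n) x) * norm ((T ^^ n) y) * 4" unfolding p_def by (rule norm_ip_le)
    also have "\<dots> \<le> (K ^ n * norm x) * (K ^ n * norm y) * 4"
      by (intro mult_right_mono mult_mono Tn) (simp_all add: K(2))
    finally show ?thesis by (simp add: power_mult_distrib power2_eq_square mult_ac)
  qed
  show ?case
  proof (intro exI[of _ "\<lambda>n. p n + s n"] exI[of _ "norm x * norm y * 4 + C"] conjI allI)
    show "norm (p n + s n) \<le> (norm x * norm y * 4 + C) * (K\<^sup>2) ^ n" for n
      using norm_triangle_mono[OF np s(4)] by (simp add: distrib_right)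
    show "mult_rel (p n + s n) (p (Suc n) + s (Suc n))" for n
      unfolding p_def by (auto intro!: mult_rel.add s(3))
  qed (simp_all add: p_def s)
qed

text \<open>
  Along an orbit \<open>s\<close> of the relation \<open>\<parallel>s n\<parallel>\<^sup>2 \<le> \<parallel>s 0\<parallel> \<parallel>s (2 n)\<parallel>\<close>, so the constant \<open>C\<close> of the geometric growth
  drops out under repeated squaring.
\<close>

lemma mult_rel_norm: "\<exists>t\<ge>0. \<forall>a b. mult_rel a b \<longrightarrow> norm b \<le> t * norm a"
proof -
  obtain K where K: "K \<ge> 0" "\<And>x. norm (T x) \<le> K * norm x"
    using bounded_linear.nonneg_bounded[OF T_bounded_linear] by (metis mult.commute)
  have "norm b \<le> K\<^sup>2 * norm a" if ab: "mult_rel a b" for a b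
  proof -
    obtain s C where s: "s 0 = a" "s (Suc 0) = b" "\<And>n. mult_rel (s n) (s (Suc n))"
      "\<And>n. norm (s n) \<le> C * (K\<^sup>2) ^ n" using mult_rel_orbit[OF K(2,1) ab] by blast
    \<comment> \<open>Each use of \<open>mult_rel_swap\<close> moves one factor
      \<open>\<kappa>\<close> from the left element to the right one.\<close>
    have shift: "adj (s (i + k)) * s j = adj (s i) * s (j + k)" for i j k
    proof (induction k arbitrary: j)
      case (Suc k)
      have "adj (s (i + Suc k)) * s j = adj (s (i + k)) * s (Suc j)"
        using mult_rel_swap[OF mult_rel_adj[OF s(3)[of "i + k"]] s(3)[of j]] by simp
      then show ?case by (simp add: Suc)
    qed simp
    have sq: "(norm (s n))\<^sup>2 \<le> norm a * norm (s (2 * n))" for n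
      using shift[of 0 n n] norm_mult_ineq[of "adj (s 0)" "s (2 * n)"]
      by (simp add: s(1) mult_2 flip: cstar_identity)
    show ?thesis
    proof (cases "norm a = 0")
      case True
      then show ?thesis using sq[of 1] s(2) by simp
    next
      case False
      \<comment> \<open>Iterating \<open>sq\<close> along n = 1, 2, 4, ... compares
        \<open>b\<close>, which is \<open>s\<close> at 1, with \<open>s (2 ^ k)\<close>.\<close>
      have pow: "norm a * norm b ^ (2 ^ k) \<le> norm a ^ (2 ^ k) * norm (s (2 ^ k))" for k
      proof (induction k)
        case (Suc k)
        have "norm a * (norm a * norm b ^ (2 ^ Suc k)) = (norm a * norm b ^ (2 ^ k))\<^sup>2"
          by (simp add: power2_eq_square mult_2 power_add mult_ac)
        also have "\<dots> \<le> (norm a ^ (2 ^ k) * norm (s (2 ^ k)))\<^sup>2"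
          by (rule power_mono[OF Suc]) simp
        also have "\<dots> = norm a ^ (2 ^ Suc k) * (norm (s (2 ^ k)))\<^sup>2"
          by (simp add: power_mult_distrib mult.commute flip: power_mult)
        also have "\<dots> \<le> norm a ^ (2 ^ Suc k) * (norm a * norm (s (2 ^ Suc k)))"
          using sq[of "2 ^ k"] by (intro mult_left_mono) simp_all
        finally have "norm a * (norm a * norm b ^ (2 ^ Suc k)) \<le>
            norm a * (norm a ^ (2 ^ Suc k) * norm (s (2 ^ Suc k)))"
          by (simp add: mult_ac)
        then show ?case using False by (simp add: mult_le_cancel_left_pos)
      qed (simp add: s(2))
      show ?thesis
      proof (rule le_if_iterated_square_powers_le)
        show "norm a * norm b ^ (2 ^ k) \<le> C * (K\<^sup>2 * norm a) ^ (2 ^ k)" for k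
        proof -
          have "norm a ^ (2 ^ k) * norm (s (2 ^ k)) \<le> norm a ^ (2 ^ k) * (C * (K\<^sup>2) ^ (2 ^ k))"
            by (intro mult_left_mono s(4)) simp
          then show ?thesis using pow[of k] by (simp add: power_mult_distrib mult_ac)
        qed
      qed (use False in auto)
    qed
  qed
  then show ?thesis by (intro exI[of _ "K\<^sup>2"]) simp
qed

section \<open>The closed graph, defined on the whole algebra by fullness\<close>

definition mult_closure :: "'a \<Rightarrow> 'a \<Rightarrow> bool" where
  "mult_closure a b \<longleftrightarrow> (\<exists>A B. (\<forall>n. mult_rel (A n) (B n)) \<and> A \<longlonglongrightarrow> a \<and> B \<longlonglongrightarrow> b)"

lemma mult_closure_total: "\<exists>b. mult_closure a b"
proof -
  obtain t where t: "t \<ge> 0" "\<And>a b. mult_rel a b \<Longrightarrow> norm b \<le> t * norm a" using mult_rel_norm by blast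
  have "a \<in> closure (cspan {ip x y | x y. True})" using full by (simp add: full_def)
  then obtain A where A: "\<And>n. A n \<in> cspan {ip x y | x y. True}" "A \<longlonglongrightarrow> a"
    unfolding closure_sequential by blast
  then obtain B where B: "\<And>n. mult_rel (A n) (B n)" using mult_rel_total_span[OF A(1)] by metis
  have "Cauchy B"
  proof (rule metric_CauchyI)
    fix e :: real assume e: "e > 0"
    have "Cauchy A" using A(2) by (rule LIMSEQ_imp_Cauchy)
    \<comment> \<open>Dividing by \<open>t + 1\<close> covers the case \<open>t\<close> = 0.\<close>
    then obtain N where N: "\<And>m n. m \<ge> N \<Longrightarrow> n \<ge> N \<Longrightarrow> dist (A m) (A n) < e / (t + 1)"
      using metric_CauchyD[of A "e / (t + 1)"] e t(1) by auto
    have "dist (B m) (B n) < e" if "m \<ge> N" "n \<ge> N" for m n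
    proof -
      have "dist (B m) (B n) \<le> t * dist (A m) (A n)"
        unfolding dist_norm by (rule t(2)[OF mult_rel_diff[OF B B]])
      also have "\<dots> \<le> (t + 1) * dist (A m) (A n)" by (simp add: distrib_right)
      also have "\<dots> < (t + 1) * (e / (t + 1))" using N[OF that] t(1) by (intro mult_strict_left_mono) auto
      finally show ?thesis using t(1) by simp
    qed
    then show "\<exists>M. \<forall>m\<ge>M. \<forall>n\<ge>M. dist (B m) (B n) < e" by blast
  qed
  then obtain b where "B \<longlonglongrightarrow> b" using Cauchy_convergent convergentD by blast
  then show ?thesis using A(2) B unfolding mult_closure_def by blast
qed

lemma mult_rel_closure: "mult_rel a b \<Longrightarrow> mult_closure a b"
  unfolding mult_closure_def by (intro exI[of _ "\<lambda>_. a"] exI[of _ "\<lambda>_. b"]) simp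

lemma mult_closure_swap: "mult_closure a b \<Longrightarrow> mult_closure a' b' \<Longrightarrow> b * a' = a * b'"
proof -
  assume "mult_closure a b" "mult_closure a' b'"
  then obtain A B A' B' where *: "\<And>n. mult_rel (A n) (B n)" "A \<longlonglongrightarrow> a" "B \<longlonglongrightarrow> b"
    "\<And>n. mult_rel (A' n) (B' n)" "A' \<longlonglongrightarrow> a'" "B' \<longlonglongrightarrow> b'" unfolding mult_closure_def by blast
  have "(\<lambda>n. B n * A' n) \<longlonglongrightarrow> b * a'" "(\<lambda>n. A n * B' n) \<longlonglongrightarrow> a * b'"
    using * by (auto intro: tendsto_mult)
  then show ?thesis using mult_rel_swap[OF *(1) *(4)] by (simp add: LIMSEQ_unique)
qed

text \<open>Any \<open>c\<close> is itself related to some c', and both values of \<open>a\<close>,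
  multiplied by \<open>c\<close>, equal a c'.\<close>

lemma mult_closure_unique: "mult_closure a b \<Longrightarrow> mult_closure a b' \<Longrightarrow> b = b'"
proof (rule cstar_left_cancel)
  fix c assume "mult_closure a b" "mult_closure a b'"
  then show "b * c = b' * c" using mult_closure_total[of c] mult_closure_swap by metis
qed

lemma mult_closure_add:
  assumes "mult_closure a b" "mult_closure a' b'"
  shows "mult_closure (a + a') (b + b')"
proof -
  obtain A B A' B' where "\<And>n. mult_rel (A n) (B n)" "A \<longlonglongrightarrow> a" "B \<longlonglongrightarrow> b"
    "\<And>n. mult_rel (A' n) (B' n)" "A' \<longlonglongrightarrow> a'" "B' \<longlonglongrightarrow> b'"
    using assms unfolding mult_closure_def by blast
  then show ?thesis
    unfolding mult_closure_def
    by (intro exI[of _ "\<lambda>n. A n + A' n"] exI[of _ "\<lambda>n. B n + B' n"])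
      (simp add: mult_rel_add tendsto_add)
qed

lemma mult_closure_scaleC:
  assumes "mult_closure a b"
  shows "mult_closure (c *\<^sub>C a) (c *\<^sub>C b)"
proof -
  obtain A B where "\<And>n. mult_rel (A n) (B n)" "A \<longlonglongrightarrow> a" "B \<longlonglongrightarrow> b"
    using assms unfolding mult_closure_def by blast
  then show ?thesis
    unfolding mult_closure_def
    by (intro exI[of _ "\<lambda>n. c *\<^sub>C A n"] exI[of _ "\<lambda>n. c *\<^sub>C B n"])
      (simp add: mult_rel_scaleC bounded_linear.tendsto[OF bounded_linear_scaleC])
qed

lemma mult_closure_adj:
  assumes "mult_closure a b"
  shows "mult_closure (adj a) (adj b)"
proof -
  obtain A B where "\<And>n. mult_rel (A n) (B n)" "A \<longlonglongrightarrow> a" "B \<longlonglongrightarrow> b"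
    using assms unfolding mult_closure_def by blast
  then show ?thesis
    unfolding mult_closure_def
    by (intro exI[of _ "\<lambda>n. adj (A n)"] exI[of _ "\<lambda>n. adj (B n)"])
      (simp add: mult_rel_adj bounded_linear.tendsto[OF bounded_linear_adj])
qed

lemma mult_closure_norm: "\<exists>t. \<forall>a b. mult_closure a b \<longrightarrow> norm b \<le> t * norm a"
proof -
  obtain t where t: "t \<ge> 0" "\<And>a b. mult_rel a b \<Longrightarrow> norm b \<le> t * norm a" using mult_rel_norm by blast
  have "norm b \<le> t * norm a" if ab: "mult_closure a b" for a b
  proof -
    obtain A B where *: "\<And>n. mult_rel (A n) (B n)" "A \<longlonglongrightarrow> a" "B \<longlonglongrightarrow> b"
      using ab unfolding mult_closure_def by blast
    show ?thesis
    proof (rule LIMSEQ_le)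
      show "(\<lambda>n. norm (B n)) \<longlonglongrightarrow> norm b" "(\<lambda>n. t * norm (A n)) \<longlonglongrightarrow> t * norm a"
        by (intro tendsto_intros *)+
      show "\<exists>N. \<forall>n\<ge>N. norm (B n) \<le> t * norm (A n)" using t(2)[OF *(1)] by blast
    qed
  qed
  then show ?thesis by blast
qed

lemma selfadjoint_multiplier:
  obtains \<kappa> :: "'a multiplier" where "\<kappa> \<in> centre" "adj \<kappa> = \<kappa>"
    "\<And>x y. multiplier_embed (ip (T x) (T y)) = \<kappa> * multiplier_embed (ip x y)"
proof -
  obtain L where L: "\<And>a. mult_closure a (L a)" using mult_closure_total by metis
  have Leq: "L a = b" if "mult_closure a b" for a b using mult_closure_unique[OF L that] .
  have L_add: "L (a + b) = L a + L b" for a b by (intro Leq mult_closure_add L)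
  have L_scaleC: "L (c *\<^sub>C a) = c *\<^sub>C L a" for c a by (intro Leq mult_closure_scaleC L)
  obtain t where "\<And>a b. mult_closure a b \<Longrightarrow> norm b \<le> t * norm a" using mult_closure_norm by blast
  then have "norm (L a) \<le> norm a * t" for a using L by (simp add: mult.commute)
  then have "bounded_linear L"
    by (intro bounded_linear_intro[where K = t]) (simp_all add: L_add scaleR_scaleC L_scaleC)
  then have "bounded_clinear L" by (simp add: bounded_clinear_def L_scaleC)
  moreover have "L a * b = a * L b" for a b by (rule mult_closure_swap[OF L L])
  moreover have "L (adj a) = adj (L a)" for a by (intro Leq mult_closure_adj L)
  ultimately obtain \<kappa> where "\<kappa> \<in> centre" "adj \<kappa> = \<kappa>"
    "\<And>a. \<kappa> * multiplier_embed a = multiplier_embed (L a)"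
    using central_multiplier_exists by blast
  moreover have "L (ip x y) = ip (T x) (T y)" for x y
    by (intro Leq mult_rel_closure mult_rel_ip)
  ultimately show thesis using that by metis
qed

section \<open>Positivity of the multiplier\<close>

lemma full_annihilator:
  assumes "\<And>x y. b * ip x y = 0"
  shows "b = 0"
proof (rule cstar_left_cancel)
  fix c
  have "{ip x y | x y. True} \<subseteq> {c. b * c = 0}" using assms by auto
  moreover have "complex_vector.subspace {c. b * c = 0}"
    by (rule complex_vector.subspaceI) (simp_all add: distrib_left scaleC_mult_right scaleC_zero)
  ultimately have "cspan {ip x y | x y. True} \<subseteq> {c. b * c = 0}" by (rule complex_vector.span_minimal)
  moreover have "closed {c. b * c = 0}" by (intro closed_Collect_eq continuous_intros)
  ultimately have "closure (cspan {ip x y | x y. True}) \<subseteq> {c. b * c = 0}" by (rule closure_minimal)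
  then show "b * c = 0 * c" using full by (auto simp: full_def)
qed

text \<open>
  On vectors \<open>z\<close> in the range of the negative part \<open>n\<close> of \<open>\<kappa>\<close>, the element \<open>\<langle>T z, T z\<rangle> = \<kappa> \<langle>z, z\<rangle>\<close> is both
  positive and negative.
\<close>

lemma positive_multiplier:
  fixes \<kappa> :: "'a multiplier"
  assumes central: "\<kappa> \<in> centre" and "adj \<kappa> = \<kappa>"
    and \<kappa>: "\<And>x y. multiplier_embed (ip (T x) (T y)) = \<kappa> * multiplier_embed (ip x y)"
  shows "positive_element \<kappa>"
proof -
  obtain n S where n: "adj n = n" "adj S = S" "\<kappa> * n = - (n * n)" "S * n = n * S"
    "n * n * n = (S * n) * (S * n)" "S * S = \<kappa> + 2 *\<^sub>R n"
    and comm: "\<And>b. \<kappa> * b = b * \<kappa> \<Longrightarrow> n * b = b * n" "\<And>b. \<kappa> * b = b * \<kappa> \<Longrightarrow> S * b = b * S"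
    using selfadjoint_negative_part[OF assms(2)] by metis
  \<comment> \<open>\<open>n\<close> and \<open>S\<close> commute with whatever commutes with the
    central \<open>\<kappa>\<close>, hence with everything.\<close>
  have nc: "n * b = b * n" and Sc: "S * b = b * S" for b
    using central comm by (auto simp: centre_def)
  \<comment> \<open>The aim is \<open>n\<close>^2 = 0, tested on \<open>a\<close> and, by fullness,
    against inner products.\<close>
  have "left_mult (n * n) a = 0" for a
  proof (rule full_annihilator)
    fix x y
    define z where "z = act (left_mult n a) x"
    obtain e where e: "ip x x = adj e * e" using ip_positive[of x] by (auto simp: positive_element_def)
    obtain f where f: "ip (T z) (T z) = adj f * f" using ip_positive[of "T z"] by (auto simp: positive_element_def)
    \<comment> \<open>Chosen so that \<open>adj w * w\<close> is the image of
      \<open>a * ip x x * adj a\<close>.\<close>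
    define w where "w = multiplier_embed e * adj (multiplier_embed a)"
    have ez: "multiplier_embed (ip z y) = n * multiplier_embed (a * ip x y)" for y
      by (simp add: z_def ip_act_left times_embed left_mult_times)
    have "multiplier_embed (ip z z) = n * (adj w * w) * n"
    proof -
      have "multiplier_embed (ip z z) = n * multiplier_embed (a * ip x x * adj (left_mult n a))"
        unfolding ez by (simp add: z_def ip_act_right mult.assoc)
      also have "\<dots> = n * (multiplier_embed a * multiplier_embed (ip x x) * adj (n * multiplier_embed a))"
        by (simp only: times_embed adj_embed mult_embed[symmetric])
      also have "multiplier_embed (ip x x) = adj (multiplier_embed e) * multiplier_embed e"
        by (simp add: e adj_embed mult_embed)
      finally show ?thesis by (simp add: w_def adj_mult adj_adj n(1) mult.assoc)
    qed
    then have "adj (multiplier_embed f) * multiplier_embed f = \<kappa> * (n * (adj w * w) * n)"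
      using \<kappa>[of z z] by (simp add: f adj_embed mult_embed)
    also have "\<dots> = - (n * n * n) * (adj w * w)"
      using nc[of "adj w * w"] n(3) by (metis mult.assoc mult_minus_left nc)
    \<comment> \<open>\<open>S * n\<close> is a self-adjoint root of \<open>n\<close>^3, which
      brings the right side into the form required by \<open>adj_mult_add_eq_0\<close>.\<close>
    also have "\<dots> = - (adj (w * (S * n)) * (w * (S * n)))"
    proof -
      have "adj (w * (S * n)) * (w * (S * n)) = (S * n) * (adj w * w) * (S * n)"
        by (simp add: adj_mult n(1,2) mult.assoc) (metis mult.assoc n(4))
      also have "\<dots> = (S * n) * (S * n) * (adj w * w)"
        by (metis mult.assoc nc Sc)
      finally show ?thesis unfolding n(5) by simp
    qed
    finally have "adj (multiplier_embed f) * multiplier_embed f + adj (w * (S * n)) * (w * (S * n)) = 0"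
      by simp
    then have "multiplier_embed f = 0" by (rule adj_mult_add_eq_0)
    then have "ip (T z) (T z) = 0" by (simp add: f embed_eq_0_iff)
    then have "T z = 0" by (simp add: ip_eq_zero)
    then have "ip (T z) (T y) = 0" using ip_zero_right[of "T y"] by (metis adj_zero ip_adj)
    then have "multiplier_embed (ip (T z) (T y)) = 0" by (simp add: embed_eq_0_iff)
    then have "\<kappa> * multiplier_embed (ip z y) = 0" by (simp add: \<kappa>)
    \<comment> \<open><z, y> carries a factor \<open>n\<close>, and
      \<open>\<kappa> * n = - (n * n)\<close>.\<close>
    then have "n * n * multiplier_embed (a * ip x y) = 0"
      unfolding ez by (simp add: n(3) flip: mult.assoc)
    then show "left_mult (n * n) a * ip x y = 0"
      unfolding times_embed embed_eq_0_iff left_mult_times .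
  qed
  then have "norm (n * n) = 0"
    using norm_multiplier_bound[of 0 "n * n"] by simp
  then have "n = 0" using norm_selfadjoint_square[OF n(1)] by simp
  then have "\<kappa> = adj S * S" using n(2,6) by simp
  then show ?thesis by (auto simp: positive_element_def)
qed

end

theorem theorem1p4:
  fixes act :: "'a::cstar_algebra \<Rightarrow> 'm::complex_banach \<Rightarrow> 'm"
    and ip :: "'m \<Rightarrow> 'm \<Rightarrow> 'a"
    and T :: "'m \<Rightarrow> 'm"
  assumes "hilbert_module act ip"
    and "full ip"
    and "bounded_module_map act T"
    and "orthogonality_preserving ip T"
  shows "\<exists>\<kappa> :: 'a multiplier. \<kappa> \<in> centre \<and> positive_element \<kappa> \<and>
    (\<forall>x y. multiplier_embed (ip (T x) (T y)) = \<kappa> * multiplier_embed (ip x y))"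
proof -
  interpret full_orthogonality_preserving act ip T
    using assms
    by (simp add: full_orthogonality_preserving_def orthogonality_preserving_module_map_def
        orthogonality_preserving_module_map_axioms_def full_orthogonality_preserving_axioms_def)
  obtain \<kappa> :: "'a multiplier" where \<kappa>: "\<kappa> \<in> centre" "adj \<kappa> = \<kappa>"
    "\<And>x y. multiplier_embed (ip (T x) (T y)) = \<kappa> * multiplier_embed (ip x y)"
    using selfadjoint_multiplier by blast
  moreover have "positive_element \<kappa>" by (rule positive_multiplier[OF \<kappa>])
  ultimately show ?thesis by blast
qed

end
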